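(* Let $4-Q<\alpha<Q$. Then for every $r>0$ and every $\phi\in C_0^\infty(B_r)$, $$\int_{B_r}\frac{\rho^{\alpha}}{|\nabla_\gamma\rho|^2}|\Delta_\gamma\phi|^2\,dz\ \ge\ \frac{(Q+\alpha-4)^2(Q-\alpha)^2}{16}\int_{B_r}\rho^{\alpha-4}|\nabla_\gamma\rho|^2\phi^2\,dz+\frac{(Q+\alpha-4)(Q-\alpha)}{8}\int_{B_r}\rho^{\alpha-4}|\nabla_\gamma\rho|^2\frac{\phi^2}{\big(\ln\frac{r}{\rho}\big)^2}\,dz .$$
   Context: Points of $\mathbb{R}^n$ are written $z=(x,y)$ with $x\in\mathbb{R}^m$, $y\in\mathbb{R}^k$, $m,k\ge1$, $n=m+k$, and $\gamma>0$. The Baouendi–Grushin gradient is $\nabla_\gamma=(\partial_{x_1},\dots,\partial_{x_m},|x|^\gamma\partial_{y_1},\dots,|x|^\gamma\partial_{y_k})$, and the Baouendi–Grushin operator is $\Delta_\gamma=\nabla_\gamma\cdot\nabla_\gamma=\Delta_x+|x|^{2\gamma}\Delta_y$. The homogeneous dimension is $Q=m+(1+\gamma)k$. The gauge is $\rho(z)=\big(|x|^{2(1+\gamma)}+(1+\gamma)^2|y|^2\big)^{\frac{1}{2(1+\gamma)}}$; one has $|\nabla_\gamma\rho|=|x|^\gamma/\rho^\gamma$. For $r>0$, $B_r=\{z\in\mathbb{R}^n:\rho(z)<r\}$. The integral on the left-hand side is allowed to be $+\infty$. *)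

theory Defs
  imports "HOL-Analysis.Analysis"
begin

definition dirderiv :: "('a::real_normed_vector \<Rightarrow> real) \<Rightarrow> 'a \<Rightarrow> 'a \<Rightarrow> real" where
  "dirderiv f v z = frechet_derivative f (at z) v"

coinductive smooth_fun :: "('a::real_normed_vector \<Rightarrow> real) \<Rightarrow> bool" where
  "(\<forall>z. f differentiable (at z)) \<Longrightarrow> (\<forall>v. smooth_fun (dirderiv f v)) \<Longrightarrow> smooth_fun f"

definition Qdim :: "real \<Rightarrow> ('m::finite) itself \<Rightarrow> ('k::finite) itself \<Rightarrow> real" where
  "Qdim \<gamma> TYPE('m) TYPE('k) = real CARD('m) + (1 + \<gamma>) * real CARD('k)"

definition gauge :: "real \<Rightarrow> (real^'m) \<times> (real^'k) \<Rightarrow> real" where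
  "gauge \<gamma> z = (norm (fst z) powr (2 * (1 + \<gamma>)) + (1 + \<gamma>)^2 * (norm (snd z))^2)
                  powr (1 / (2 * (1 + \<gamma>)))"

definition grad_gauge_norm :: "real \<Rightarrow> (real^'m) \<times> (real^'k) \<Rightarrow> real" where
  "grad_gauge_norm \<gamma> z = norm (fst z) powr \<gamma> / gauge \<gamma> z powr \<gamma>"

definition gball :: "real \<Rightarrow> real \<Rightarrow> ((real^'m) \<times> (real^'k)) set" where
  "gball \<gamma> r = {z. gauge \<gamma> z < r}"

definition grushin_lap :: "real \<Rightarrow> ((real^'m) \<times> (real^'k) \<Rightarrow> real) \<Rightarrow> (real^'m) \<times> (real^'k) \<Rightarrow> real" where
  "grushin_lap \<gamma> f z =
     (\<Sum>i\<in>UNIV. dirderiv (dirderiv f (axis i 1, 0)) (axis i 1, 0) z)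
     + norm (fst z) powr (2 * \<gamma>) *
       (\<Sum>j\<in>UNIV. dirderiv (dirderiv f (0, axis j 1)) (0, axis j 1) z)"

end

(* A completed square gives rho^alpha / |grad rho|^2 * (Delta phi)^2 >= - 2 C rho^(alpha-2) phi Delta phi - C^2 S phi^2
   with C = (Q + alpha - 4) (Q - alpha) / 4 and S = rho^(alpha-4) |grad rho|^2. Integrating phi Delta phi by parts
   leaves a weighted Dirichlet integral, to which the Hardy inequality with ground state
   rho^(-(Q+alpha-4)/2) (ln (r / rho))^(1/2) applies. Both steps amount to subtracting the divergence of a single vector
   field, so it suffices to prove a pointwise inequality and that this divergence integrates to 0. The field is
   singular at 0, but the derivatives entering its divergence are O(rho^(alpha-4)), which is integrable near 0 since
   alpha > 4 - Q, and almost every line in a coordinate direction misses 0; hence no cut-off is needed. *)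

theory Submission
  imports Defs
begin

subsection \<open>Integrals of directional derivatives\<close>

text \<open>Origin of the field: put L = ln (r / rho). Hardy's inequality, taken twice, contributes
  - phi^2 rho^(alpha-3) (Q + alpha - 4 + 1/L) grad rho. The cross term 2 (alpha-2) rho^(alpha-3) phi
  grad phi grad rho left by the first integration by parts contributes + (alpha-2) phi^2
  rho^(alpha-3) grad rho. So alpha cancels and the factor Q - 2 + 1/L remains. The resulting lower
  bound for - 2 rho^(alpha-2) phi Delta phi is (2 C + 1 / (2 L^2)) S phi^2; a multiplier t in the
  completed square yields 2 t C - t^2, which is largest at t = C. The exponent 1/2 of the logarithm
  maximises the coefficient of 1/L^2. An obstacle is the set x = 0: there |x|^(2 gamma) need not be
  differentiable, and for m = 1 every line in the x-direction crosses it. Continuity of the field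
  away from 0 makes finitely many crossings harmless. The divergence is integrated one coordinate at
  a time, so each single derivative has to be integrable; this is why the shares of the coordinates
  in Z rho = rho are bounded individually.\<close>

lemma integrable_translate_lborel:
  fixes f :: "'a::euclidean_space \<Rightarrow> real"
  assumes "integrable lborel f"
  shows "integrable lborel (\<lambda>z. f (z + a))" and "(LINT z|lborel. f (z + a)) = (LINT z|lborel. f z)"
proof -
  have d: "distr lborel borel (\<lambda>z. z + a) = (lborel :: 'a measure)"
    using lborel_distr_plus[of a] by (simp add: add.commute[of _ a])
  have m: "f \<in> borel_measurable borel"
    using borel_measurable_integrable[OF assms] by simp
  show "integrable lborel (\<lambda>z. f (z + a))"
    using assms integrable_distr_eq[of "\<lambda>z. z + a" lborel borel f] m by (simp add: d)
  show "(LINT z|lborel. f (z + a)) = (LINT z|lborel. f z)"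
    using integral_distr[of "\<lambda>z. z + a" lborel borel f] m by (simp add: d)
qed

text \<open>Averaging \<open>f'\<close> over the segments from \<open>z\<close> to \<open>z + b\<close> and using translation invariance turns
  \<open>\<integral> f'\<close> into \<open>\<integral> f(z + b) - f(z) dz\<close>, so no decomposition of the space along \<open>b\<close> is needed.\<close>

lemma integral_directional_derivative_eq_0:
  fixes f f' :: "'a::euclidean_space \<Rightarrow> real"
  assumes f: "integrable lborel f" and f': "integrable lborel f'"
    and lines: "AE z in lborel. \<exists>E. finite E \<and> continuous_on {0..1} (\<lambda>t. f (z + t *\<^sub>R b))
      \<and> (\<forall>t. t \<notin> E \<longrightarrow> ((\<lambda>t. f (z + t *\<^sub>R b)) has_real_derivative f' (z + t *\<^sub>R b)) (at t))"
  shows "(LINT z|lborel. f' z) = 0"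
proof -
  define F where "F = (\<lambda>(t::real) z. indicator {0..1} t * f' (z + t *\<^sub>R b))"
  have [measurable]: "f' \<in> borel_measurable borel"
    using borel_measurable_integrable[OF f'] by simp
  have meas: "case_prod F \<in> borel_measurable (lborel \<Otimes>\<^sub>M lborel)"
    unfolding F_def by measurable
  have "integrable lborel (\<lambda>t::real. indicator {0..1} t * (LINT z|lborel. \<bar>f' z\<bar>))"
    by (intro integrable_mult_left integrable_real_indicator) auto
  then have int: "integrable (lborel \<Otimes>\<^sub>M lborel) (case_prod F)"
    by (intro lborel_pair.Fubini_integrable[OF meas] AE_I2)
      (auto simp: F_def abs_mult integrable_translate_lborel(1)[OF f'] 
        integrable_translate_lborel(2)[OF integrable_abs[OF f']])
  have "(LINT z|lborel. f' z) = (LINT t|lborel. LINT z|lborel. F t z)"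
    by (simp add: F_def integrable_translate_lborel(2)[OF f'])
  also have "\<dots> = (LINT z|lborel. LINT t|lborel. F t z)"
    using lborel_pair.Fubini_integral[OF int] by simp
  also have "\<dots> = (LINT z|lborel. f (z + b) - f z)"
  proof (rule integral_cong_AE)
    show "(\<lambda>z. LINT t|lborel. F t z) \<in> borel_measurable lborel"
      using lborel_pair.integrable_snd[OF int] by (rule borel_measurable_integrable)
    show "(\<lambda>z. f (z + b) - f z) \<in> borel_measurable lborel"
      using integrable_translate_lborel(1)[OF f] f by (intro borel_measurable_diff) auto
    show "AE z in lborel. (LINT t|lborel. F t z) = f (z + b) - f z"
      \<comment> \<open>The fundamental theorem gives only a gauge integral of \<open>f'\<close>
        along the segment; Fubini supplies the absolute integrability on almost every segment that
        identifies it with the Lebesgue integral.\<close>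
      using lborel_pair.AE_integrable_snd[OF int] lines
    proof eventually_elim
      case (elim z)
      then obtain E where E: "finite E" "continuous_on {0..1} (\<lambda>t. f (z + t *\<^sub>R b))"
        "\<And>t. t \<notin> E \<Longrightarrow> ((\<lambda>t. f (z + t *\<^sub>R b)) has_real_derivative f' (z + t *\<^sub>R b)) (at t)"
        by blast
      have si: "set_integrable lborel {0..1::real} (\<lambda>t. f' (z + t *\<^sub>R b))"
        using elim(1) unfolding set_integrable_def F_def by simp
      have "((\<lambda>t. f' (z + t *\<^sub>R b)) has_integral (f (z + 1 *\<^sub>R b) - f (z + 0 *\<^sub>R b))) {0..1}"
        using fundamental_theorem_of_calculus_interior_strong[OF E(1) zero_le_one _ E(2)] E(3)
        by (simp add: has_real_derivative_iff_has_vector_derivative)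
      then have "integral {0..1} (\<lambda>t. f' (z + t *\<^sub>R b)) = f (z + b) - f z"
        by (simp add: integral_unique)
      then show ?case
        using set_borel_integral_eq_integral(2)[OF si]
        by (simp add: set_lebesgue_integral_def F_def)
    qed
  qed
  also have "\<dots> = 0"
    using integrable_translate_lborel[OF f, of b] f by (simp add: integrable_translate_lborel)
  finally show ?thesis .
qed

subsection \<open>The gauge\<close>

lemma gauge_nonneg: "0 \<le> gauge \<gamma> z"
  by (simp add: gauge_def)

lemma gauge_powr:
  assumes "\<gamma> > 0"
  shows "gauge \<gamma> z powr (2 * (1 + \<gamma>)) = norm (fst z) powr (2 * (1 + \<gamma>)) + (1 + \<gamma>)^2 * (norm (snd z))^2"
  using assms by (simp add: gauge_def powr_powr)

lemma norm_fst_le_gauge: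
  assumes "\<gamma> > 0"
  shows "norm (fst z) \<le> gauge \<gamma> z"
proof -
  have "norm (fst z) powr (2 * (1 + \<gamma>)) \<le> gauge \<gamma> z powr (2 * (1 + \<gamma>))"
    using gauge_powr[OF assms, of z] by simp
  then show ?thesis
    using powr_le_cancel_iff powr_less_mono2[of "2 * (1 + \<gamma>)" "gauge \<gamma> z" "norm (fst z)"] gauge_nonneg[of \<gamma> z] assms
    by (meson add_pos_pos linorder_not_less mult_pos_pos zero_less_numeral zero_less_one)
qed

lemma norm_snd_le_gauge:
  assumes "\<gamma> > 0"
  shows "(1 + \<gamma>) * norm (snd z) \<le> gauge \<gamma> z powr (1 + \<gamma>)"
proof -
  have "((1 + \<gamma>) * norm (snd z))^2 \<le> gauge \<gamma> z powr (2 * (1 + \<gamma>))"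
    using gauge_powr[OF assms, of z] by (simp add: power_mult_distrib)
  also have "\<dots> = (gauge \<gamma> z powr (1 + \<gamma>))^2"
    by (simp add: power2_eq_square powr_add[symmetric])
  finally show ?thesis
    by (rule power2_le_imp_le) simp
qed

lemma gauge_pos_iff: "\<gamma> > 0 \<Longrightarrow> gauge \<gamma> z > 0 \<longleftrightarrow> z \<noteq> 0"
  unfolding gauge_def by (auto simp: less_le prod_eq_iff add_nonneg_eq_0_iff)

lemma continuous_gauge:
  assumes "\<gamma> > 0"
  shows "continuous_on UNIV (gauge \<gamma>)"
  unfolding gauge_def using assms
  by (intro continuous_intros continuous_on_powr') auto

lemma measurable_gauge [measurable]: "\<gamma> > 0 \<Longrightarrow> gauge \<gamma> \<in> borel_measurable borel"
  by (rule borel_measurable_continuous_onI[OF continuous_gauge])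

lemma measurable_grad_gauge_norm [measurable]: 
  assumes [arith]: "\<gamma> > 0"
  shows "(grad_gauge_norm \<gamma> :: (real^'m) \<times> (real^'k) \<Rightarrow> _) \<in> borel_measurable borel"
proof -
  have [measurable]: "(fst :: (real^'m) \<times> (real^'k) \<Rightarrow> _) \<in> borel_measurable borel"
    by (intro borel_measurable_continuous_onI continuous_intros)
  show ?thesis unfolding grad_gauge_norm_def by measurable
qed

lemma gball_measurable [measurable]: "\<gamma> > 0 \<Longrightarrow> gball \<gamma> r \<in> sets borel"
  unfolding gball_def by measurable

section \<open>Volume of gauge balls and integrability of powers of the gauge\<close>

lemma emeasure_cube:
  assumes "t \<ge> 0"
  shows "emeasure lborel (cbox (\<chi> i. - t) (\<chi> i. t) :: (real^'n) set) = ennreal ((2 * t) ^ CARD('n))"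
proof -
  have "((\<chi> i. t) - (\<chi> i. - t) :: real^'n) \<bullet> b = 2 * t" if "b \<in> Basis" for b
    using that by (auto simp: Basis_vec_def inner_axis)
  moreover have "(\<chi> i. - t :: real^'n) \<bullet> b \<le> (\<chi> i. t) \<bullet> b" if "b \<in> Basis" for b :: "real^'n"
    using that assms by (auto simp: Basis_vec_def inner_axis)
  ultimately show ?thesis
    by (simp add: emeasure_lborel_cbox_eq prod_constant)
qed

text \<open>The ball lies in a product of cubes of half-side t in x and t^(1+\<gamma>) in y;
  counting exponents over the m + k axes gives the homogeneous dimension. Only this upper bound on
  the volume is used later.\<close>

lemma emeasure_gball_le:
  assumes "\<gamma> > 0" "t > 0"
  shows "emeasure lborel (gball \<gamma> t :: ((real^'m) \<times> (real^'k)) set) 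
    \<le> ennreal (2 ^ (CARD('m) + CARD('k)) * t powr Qdim \<gamma> TYPE('m) TYPE('k))"
proof -
  let ?A = "cbox (\<chi> i. - t) (\<chi> i. t) :: (real^'m) set"
  let ?u = "t powr (1 + \<gamma>)"
  let ?B = "cbox (\<chi> i. - ?u) (\<chi> i. ?u) :: (real^'k) set"
  have "gball \<gamma> t \<subseteq> ?A \<times> ?B"
  proof
    fix z :: "(real^'m) \<times> (real^'k)" assume "z \<in> gball \<gamma> t"
    then have g: "gauge \<gamma> z < t" by (simp add: gball_def)
    have 1: "norm (fst z) \<le> t" using norm_fst_le_gauge[OF assms(1), of z] g by simp
    have "norm (snd z) \<le> (1 + \<gamma>) * norm (snd z)" using assms by (simp add: mult_le_cancel_right1)
    also have "\<dots> \<le> ?u" 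
      using norm_snd_le_gauge[OF assms(1), of z] powr_mono2[of "1 + \<gamma>" "gauge \<gamma> z" t] g assms gauge_nonneg[of \<gamma> z] by simp
    finally have 2: "norm (snd z) \<le> ?u" .
    show "z \<in> ?A \<times> ?B"
      using 1 2 component_le_norm_cart[of "fst z"] component_le_norm_cart[of "snd z"]
      by (auto simp: mem_Times_iff mem_box_cart abs_le_iff)
         (smt (verit) component_le_norm_cart)+
  qed
  then have "emeasure lborel (gball \<gamma> t :: ((real^'m) \<times> (real^'k)) set) \<le> emeasure lborel (?A \<times> ?B)"
    by (intro emeasure_mono) (auto intro!: borel_Times)
  also have "\<dots> = emeasure lborel ?A * emeasure lborel ?B"
    by (simp add: lborel_prod[symmetric] lborel.emeasure_pair_measure_Times)
  also have "\<dots> = ennreal ((2 * t) ^ CARD('m) * (2 * ?u) ^ CARD('k))"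
    using assms by (simp add: emeasure_cube ennreal_mult)
  also have "(2 * t) ^ CARD('m) * (2 * ?u) ^ CARD('k) = 2 ^ (CARD('m) + CARD('k)) * t powr Qdim \<gamma> TYPE('m) TYPE('k)"
    using assms
    by (simp add: power_mult_distrib power_add Qdim_def powr_add powr_realpow[symmetric] powr_powr distrib_right)
  finally show ?thesis .
qed

text \<open>Dyadic decomposition into shells R / 2^(j+1) \<le> \<rho> < R / 2^j. On each shell
  \<rho>^\<beta> is comparable to its value at the outer radius, and bounding the shell by the whole
  ball gives a geometric series with ratio 2^(-(Q+\<beta>)) < 1.\<close>

lemma gauge_powr_integrable:
  assumes "\<gamma> > 0" "R > 0" "\<beta> > - Qdim \<gamma> TYPE('m) TYPE('k)"
  shows "integrable lborel (\<lambda>z :: (real^'m) \<times> (real^'k). indicator (gball \<gamma> R) z * gauge \<gamma> z powr \<beta>)"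
proof (rule integrableI_nonneg)
  let ?Q = "Qdim \<gamma> TYPE('m) TYPE('k)"
  define n where "n = CARD('m) + CARD('k)"
  \<comment> \<open>Ratios u in [1/2, 1) satisfy u^\<beta> \<le> 2^|\<beta>| for either sign of
    \<beta>.\<close>
  define c where "c = 2 powr \<bar>\<beta>\<bar>"
  define R' where "R' j = R / 2 ^ j" for j :: nat
  have R': "R' j > 0" for j using assms by (simp add: R'_def)
  define q where "q = (1/2::real) powr (?Q + \<beta>)"
  have [measurable]: "\<gamma> > 0" by fact
  show "(\<lambda>z :: (real^'m) \<times> (real^'k). indicator (gball \<gamma> R) z * gauge \<gamma> z powr \<beta>) \<in> borel_measurable lborel"
    by measurable
  show "AE z :: (real^'m) \<times> (real^'k) in lborel. 0 \<le> indicator (gball \<gamma> R) z * gauge \<gamma> z powr \<beta>" by simp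
  have q: "0 < q" "q < 1" using assms by (auto simp: q_def powr_divide)
  have Rq: "R' j powr (?Q + \<beta>) = R powr (?Q + \<beta>) * q ^ j" for j
  proof -
    have "R' j powr (?Q + \<beta>) = R powr (?Q + \<beta>) / (2 ^ j) powr (?Q + \<beta>)"
      using assms by (simp add: R'_def powr_divide)
    also have "(2 ^ j :: real) powr (?Q + \<beta>) = (2 powr (?Q + \<beta>)) ^ j"
      by (simp add: powr_realpow[symmetric] powr_powr mult.commute)
    finally show ?thesis by (simp add: q_def powr_divide power_divide)
  qed
  have "ennreal (indicator (gball \<gamma> R) z * gauge \<gamma> z powr \<beta>)
     \<le> (\<Sum>j. ennreal (c * R' j powr \<beta>) * indicator (gball \<gamma> (R' j)) z)" for z :: "(real^'m) \<times> (real^'k)"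
  proof (cases "z \<in> gball \<gamma> R \<and> z \<noteq> 0")
    case False
    \<comment> \<open>At the origin the integrand is 0, because \<open>0 powr \<beta> = 0\<close>
      also for negative \<beta>.\<close>
    then show ?thesis using gauge_pos_iff[OF assms(1), of z] gauge_nonneg[of \<gamma> z] by (auto simp: indicator_def)
  next
    case True
    then have g: "0 < gauge \<gamma> z" "gauge \<gamma> z < R"
      using gauge_pos_iff[OF assms(1), of z] by (simp_all add: gball_def)
    obtain n where "R / gauge \<gamma> z < 2 ^ n" using real_arch_pow[of 2 "R / gauge \<gamma> z"] by auto
    then have ex: "\<exists>n. R' n \<le> gauge \<gamma> z" using g by (intro exI[of _ n]) (simp add: R'_def field_simps)
    define k where "k = (LEAST n. R' n \<le> gauge \<gamma> z)"
    have k: "R' k \<le> gauge \<gamma> z" unfolding k_def using ex by (rule LeastI_ex)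
    have "k \<noteq> 0"
    proof
      assume "k = 0"
      then show False using k g by (simp add: R'_def)
    qed
    then obtain j where j: "k = Suc j" by (cases k) auto
    have lt: "gauge \<gamma> z < R' j"
      using not_less_Least[of j "\<lambda>n. R' n \<le> gauge \<gamma> z"] j by (simp add: k_def)
    have ge: "gauge \<gamma> z \<ge> R' j / 2" using k by (simp add: j R'_def)
    define u where "u = gauge \<gamma> z / R' j"
    have u: "1/2 \<le> u" "u < 1" "u > 0" using lt ge g R'[of j] by (auto simp: u_def field_simps)
    have "u powr \<beta> \<le> c"
    proof (cases "\<beta> \<ge> 0")
      case True
      then have "u powr \<beta> \<le> 1" using u by (intro powr_le1) auto
      also have "1 \<le> c" by (simp add: c_def ge_one_powr_ge_zero)
      finally show ?thesis .
    next
      case False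
      then have "u powr \<beta> \<le> (1/2) powr \<beta>" using u by (intro powr_mono2') auto
      also have "\<dots> = c" using False by (simp add: c_def powr_divide powr_minus_divide)
      finally show ?thesis .
    qed
    moreover have "gauge \<gamma> z powr \<beta> = u powr \<beta> * R' j powr \<beta>"
      using R'[of j] g by (simp add: u_def powr_divide)
    ultimately have "gauge \<gamma> z powr \<beta> \<le> c * R' j powr \<beta>" by (simp add: mult_right_mono)
    then have "ennreal (indicator (gball \<gamma> R) z * gauge \<gamma> z powr \<beta>)
       \<le> ennreal (c * R' j powr \<beta>) * indicator (gball \<gamma> (R' j)) z"
      using lt by (auto simp: gball_def indicator_def intro!: ennreal_leI)
    also have "\<dots> \<le> (\<Sum>j. ennreal (c * R' j powr \<beta>) * indicator (gball \<gamma> (R' j)) z)"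
    proof -
      have "f j \<le> suminf f" for f :: "nat \<Rightarrow> ennreal"
        using sum_le_suminf[of f "{j}"] by simp
      then show ?thesis .
    qed
    finally show ?thesis .
  qed
  then have "(\<integral>\<^sup>+ z. ennreal (indicator (gball \<gamma> R) z * gauge \<gamma> z powr \<beta>) \<partial>(lborel :: ((real^'m) \<times> (real^'k)) measure))
    \<le> (\<integral>\<^sup>+ z. (\<Sum>j. ennreal (c * R' j powr \<beta>) * indicator (gball \<gamma> (R' j)) z) \<partial>(lborel :: ((real^'m) \<times> (real^'k)) measure))"
    by (intro nn_integral_mono)
  also have "\<dots> = (\<Sum>j. ennreal (c * R' j powr \<beta>) * emeasure lborel (gball \<gamma> (R' j) :: ((real^'m) \<times> (real^'k)) set))"
    by (subst nn_integral_suminf) (auto intro!: suminf_cong nn_integral_cmult_indicator)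
  also have "\<dots> \<le> (\<Sum>j. ennreal ((c * 2 ^ n * R powr (?Q + \<beta>)) * q ^ j))"
  proof (intro suminf_le allI summableI)
    fix j
    have "ennreal (c * R' j powr \<beta>) * emeasure lborel (gball \<gamma> (R' j) :: ((real^'m) \<times> (real^'k)) set)
      \<le> ennreal (c * R' j powr \<beta>) * ennreal (2 ^ n * R' j powr ?Q)"
      unfolding n_def using emeasure_gball_le[OF assms(1) R', of j, where 'm='m and 'k='k] by (intro mult_left_mono) auto
    also have "\<dots> = ennreal ((c * 2 ^ n) * (R' j powr (?Q + \<beta>)))"
      by (simp add: ennreal_mult[symmetric] c_def powr_add mult_ac)
    also have "\<dots> = ennreal ((c * 2 ^ n * R powr (?Q + \<beta>)) * q ^ j)"
      by (simp add: Rq mult.assoc)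
    finally show "ennreal (c * R' j powr \<beta>) * emeasure lborel (gball \<gamma> (R' j) :: ((real^'m) \<times> (real^'k)) set)
      \<le> ennreal ((c * 2 ^ n * R powr (?Q + \<beta>)) * q ^ j)" .
  qed
  also have "\<dots> = ennreal (\<Sum>j. (c * 2 ^ n * R powr (?Q + \<beta>)) * q ^ j)"
    using q by (intro suminf_ennreal2 summable_mult summable_geometric) (auto simp: c_def)
  also have "\<dots> < \<infinity>" by simp
  finally show "(\<integral>\<^sup>+ z. ennreal (indicator (gball \<gamma> R) z * gauge \<gamma> z powr \<beta>) \<partial>(lborel :: ((real^'m) \<times> (real^'k)) measure)) < \<infinity>" .
qed

subsection \<open>The flux in one coordinate direction\<close>

lemma smooth_fun_differentiable: "smooth_fun f \<Longrightarrow> f differentiable (at z)"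
  by (erule smooth_fun.cases) auto

lemma smooth_fun_dirderiv: "smooth_fun f \<Longrightarrow> smooth_fun (dirderiv f v)"
  by (erule smooth_fun.cases) auto

lemma smooth_fun_continuous: "smooth_fun f \<Longrightarrow> continuous_on S f"
  using smooth_fun_differentiable differentiable_imp_continuous_within continuous_at_imp_continuous_on by blast

lemma DERIV_line_dirderiv:
  assumes "f differentiable (at z)"
  shows "((\<lambda>t. f (z + t *\<^sub>R b)) has_real_derivative dirderiv f b z) (at 0)"
proof -
  have 1: "((\<lambda>t::real. z + t *\<^sub>R b) has_derivative (\<lambda>t. t *\<^sub>R b)) (at 0)"
    by (auto intro!: derivative_eq_intros)
  have 2: "(f has_derivative frechet_derivative f (at z)) (at (z + 0 *\<^sub>R b))"
    using assms by (simp add: frechet_derivative_works)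
  have "((f \<circ> (\<lambda>t. z + t *\<^sub>R b)) has_derivative (frechet_derivative f (at z) \<circ> (\<lambda>t. t *\<^sub>R b))) (at 0)"
    by (rule diff_chain_at[OF 1 2])
  moreover have "frechet_derivative f (at z) (t *\<^sub>R b) = t * dirderiv f b z" for t
    using linear_frechet_derivative[OF assms] by (simp add: dirderiv_def linear_cmul)
  ultimately show ?thesis
    unfolding has_field_derivative_def o_def by (metis (no_types, lifting) ext mult.commute)
qed

text \<open>Moving the base point along the line allows all later derivatives to be computed at
  parameter 0 only.\<close>

lemma DERIV_line_shift:
  fixes f :: "'a::real_vector \<Rightarrow> real"
  assumes "((\<lambda>s. f ((z + t *\<^sub>R b) + s *\<^sub>R b)) has_real_derivative D) (at 0)"
  shows "((\<lambda>s. f (z + s *\<^sub>R b)) has_real_derivative D) (at t)"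
proof -
  have "(\<lambda>s. f ((z + t *\<^sub>R b) + s *\<^sub>R b)) = (\<lambda>s. f (z + (s + t) *\<^sub>R b))"
    by (auto simp: scaleR_add_left add_ac)
  then show ?thesis
    using assms DERIV_shift[of "\<lambda>s. f (z + s *\<^sub>R b)" D 0 t] by simp
qed

lemma dirderiv_eq_0_on_open:
  assumes "open U" "\<And>z. z \<in> U \<Longrightarrow> f z = 0" "z \<in> U"
  shows "dirderiv f v z = 0"
proof -
  have "(f has_derivative (\<lambda>h. 0)) (at z)"
    by (rule has_derivative_transform_within_open[of "\<lambda>z. 0" "\<lambda>h. 0" z UNIV U]) (use assms in auto)
  then show ?thesis
    unfolding dirderiv_def using frechet_derivative_at by metis
qed

lemma bounded_image_mult:
  fixes f g :: "'a \<Rightarrow> real"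
  assumes "bounded (f ` K)" "bounded (g ` K)"
  shows "bounded ((\<lambda>z. f z * g z) ` K)"
proof -
  from assms obtain A B where "\<forall>z\<in>K. \<bar>f z\<bar> \<le> A" "\<forall>z\<in>K. \<bar>g z\<bar> \<le> B"
    unfolding bounded_iff by auto
  then have "\<forall>z\<in>K. \<bar>f z * g z\<bar> \<le> A * B"
    by (fastforce simp: abs_mult intro!: mult_mono intro: order_trans[OF abs_ge_zero])
  then show ?thesis unfolding bounded_iff by auto
qed

text \<open>This is \<rho>^(\<alpha>-4) |grad \<rho>|^2 with the quotient cleared, so that the
  powers of \<rho> and |x| can be differentiated separately. It is also the factor that makes the
  second-order coefficient matrix applied to \<rho>^(\<alpha>-3) times the Euclidean gradient of
  \<rho> a multiple of (x, (1+\<gamma>) y).\<close>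

definition sing_weight :: "real \<Rightarrow> real \<Rightarrow> (real^'m) \<times> (real^'k) \<Rightarrow> real" where
  "sing_weight \<gamma> \<alpha> z = gauge \<gamma> z powr (\<alpha> - 4 - 2 * \<gamma>) * norm (fst z) powr (2 * \<gamma>)"

definition log_gauge :: "real \<Rightarrow> real \<Rightarrow> (real^'m) \<times> (real^'k) \<Rightarrow> real" where
  "log_gauge \<gamma> r z = ln (r / gauge \<gamma> z)"

lemma sing_weight_nonneg: "0 \<le> sing_weight \<gamma> \<alpha> z"
  by (simp add: sing_weight_def)

lemma sing_weight_le:
  assumes "\<gamma> > 0"
  shows "sing_weight \<gamma> \<alpha> z \<le> gauge \<gamma> z powr (\<alpha> - 4)"
proof -
  have "norm (fst z) powr (2 * \<gamma>) \<le> gauge \<gamma> z powr (2 * \<gamma>)"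
    using norm_fst_le_gauge[OF assms, of z] assms by (intro powr_mono2) auto
  then have "sing_weight \<gamma> \<alpha> z \<le> gauge \<gamma> z powr (\<alpha> - 4 - 2 * \<gamma>) * gauge \<gamma> z powr (2 * \<gamma>)"
    unfolding sing_weight_def by (intro mult_left_mono) auto
  also have "\<dots> = gauge \<gamma> z powr (\<alpha> - 4)"
    by (simp add: powr_add[symmetric])
  finally show ?thesis .
qed

lemma measurable_fst_borel [measurable]:
  "(fst :: ('a::euclidean_space) \<times> ('b::euclidean_space) \<Rightarrow> 'a) \<in> borel_measurable borel"
  by (intro borel_measurable_continuous_onI continuous_intros)

lemma measurable_snd_borel [measurable]:
  "(snd :: ('a::euclidean_space) \<times> ('b::euclidean_space) \<Rightarrow> 'b) \<in> borel_measurable borel"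
  by (intro borel_measurable_continuous_onI continuous_intros)

lemma measurable_sing_weight [measurable]:
  fixes \<gamma> :: real assumes [measurable]: "\<gamma> > 0"
  shows "(sing_weight \<gamma> \<alpha> :: (real^'m) \<times> (real^'k) \<Rightarrow> _) \<in> borel_measurable borel"
  unfolding sing_weight_def by measurable

lemma measurable_log_gauge [measurable]:
  fixes \<gamma> :: real assumes [measurable]: "\<gamma> > 0"
  shows "(log_gauge \<gamma> r :: (real^'m) \<times> (real^'k) \<Rightarrow> _) \<in> borel_measurable borel"
  unfolding log_gauge_def by measurable

text \<open>\<open>D\<close> is the coefficient of the second derivative in direction \<open>b\<close> and \<open>Z\<close> the component of the
  dilation generator \<open>(x, (1 + \<gamma>) y)\<close>. With \<open>q = Q - 2\<close>, \<open>flux\<close> is the component of the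
  field \<open>- 2 \<rho>\<^bsup>\<alpha> - 2\<^esup> \<phi> \<nabla>\<phi> - \<phi>\<^sup>2 \<rho>\<^bsup>\<alpha> - 3\<^esup> (Q - 2 + 1 / ln (r / \<rho>)) \<nabla>\<rho>\<close>.\<close>

definition flux where
  "flux \<gamma> \<alpha> r q \<phi> b D Z z =
     - 2 * gauge \<gamma> z powr (\<alpha> - 2) * D z * \<phi> z * dirderiv \<phi> b z
     - (\<phi> z)\<^sup>2 * sing_weight \<gamma> \<alpha> z * Z z * (q + 1 / log_gauge \<gamma> r z)"

text \<open>The derivative of \<open>flux\<close> along \<open>b\<close>, with the singular factors
  pulled out in front of terms bounded on the support. Here \<open>c\<close> stands for the
  derivative of \<open>Z\<close>, \<open>e\<close> for \<open>Z\<close> times the logarithmic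
  derivative of \<rho>, and 2 \<gamma> \<open>d\<close> for \<open>Z\<close> times that of
  |x|^(2\<gamma>). Passing \<open>e\<close> and \<open>d\<close> as functions keeps them defined and
  bounded everywhere.\<close>

definition flux_deriv where
  "flux_deriv \<gamma> \<alpha> r q \<phi> b D Z c e d z =
     gauge \<gamma> z powr (\<alpha> - 2) * (- 2 * (D z * ((dirderiv \<phi> b z)\<^sup>2 + \<phi> z * dirderiv (dirderiv \<phi> b) b z)))
     + sing_weight \<gamma> \<alpha> z * (- 2 * (\<phi> z * dirderiv \<phi> b z * Z z * (\<alpha> - 2 + q + 1 / log_gauge \<gamma> r z))
        - (\<phi> z)\<^sup>2 * ((q + 1 / log_gauge \<gamma> r z) * (c + (\<alpha> - 4 - 2 * \<gamma>) * e z + 2 * \<gamma> * d z)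
            + e z * (1 / log_gauge \<gamma> r z)\<^sup>2))"

lemma DERIV_flux_1d:
  fixes p p1 rho D n Z :: "real \<Rightarrow> real"
  assumes p: "(p has_real_derivative p1 t) (at t)" and p1: "(p1 has_real_derivative p2) (at t)"
    and rho: "(rho has_real_derivative R) (at t)" and n: "(n has_real_derivative n') (at t)"
    and Z: "(Z has_real_derivative c) (at t)" and D: "(D has_real_derivative 0) (at t)"
    and r: "0 < rho t" "rho t < r"
    and DR: "D t * R * rho t powr (1 + 2 * \<gamma>) = n t * Z t"
    and e: "e = Z t * R / rho t" and d: "n' * Z t = 2 * \<gamma> * n t * d"
  shows "((\<lambda>t. - 2 * rho t powr (\<alpha> - 2) * D t * p t * p1 t
      - (p t)\<^sup>2 * (rho t powr (\<alpha> - 4 - 2 * \<gamma>) * n t) * Z t * (q + 1 / ln (r / rho t)))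
    has_real_derivative
     rho t powr (\<alpha> - 2) * (- 2 * (D t * ((p1 t)\<^sup>2 + p t * p2)))
     + (rho t powr (\<alpha> - 4 - 2 * \<gamma>) * n t) * (- 2 * (p t * p1 t * Z t * (\<alpha> - 2 + q + 1 / ln (r / rho t)))
        - (p t)\<^sup>2 * ((q + 1 / ln (r / rho t)) * (c + (\<alpha> - 4 - 2 * \<gamma>) * e + 2 * \<gamma> * d)
            + e * (1 / ln (r / rho t))\<^sup>2))) (at t)"
proof -
  define X where "X = R / rho t"
  define l where "l = 1 / ln (r / rho t)"
  define S where "S = rho t powr (\<alpha> - 4 - 2 * \<gamma>)"
  define P where "P = rho t powr (\<alpha> - 2)"
  have L: "((\<lambda>t. 1 / ln (r / rho t)) has_real_derivative X * l\<^sup>2) (at t)"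
    using r unfolding X_def l_def
    by (auto intro!: derivative_eq_intros rho simp: field_simps power2_eq_square)
  have pw: "((\<lambda>t. rho t powr \<beta>) has_real_derivative rho t powr \<beta> * (\<beta> * X)) (at t)" for \<beta>
    using r unfolding X_def by (auto intro!: derivative_eq_intros rho simp: field_simps powr_diff)
  have "P = S * (rho t powr (1 + 2 * \<gamma>) * rho t)"
    using r by (simp add: P_def S_def powr_add[symmetric] powr_mult_base mult.commute)
  \<comment> \<open>This converts the derivative of the power \<rho>^(\<alpha>-2) into a cross term
    of the same shape as the one from differentiating \<phi>^2, which produces the factor \<alpha> -
    2 + q + 1 / ln.\<close>
  then have SD: "P * D t * X = S * n t * Z t"
    using DR r by (simp add: X_def mult_ac)
  have e': "e = Z t * X" by (simp add: X_def e)
  have *: "((\<lambda>t. - 2 * rho t powr (\<alpha> - 2) * D t * p t * p1 t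
      - (p t)\<^sup>2 * (rho t powr (\<alpha> - 4 - 2 * \<gamma>) * n t) * Z t * (q + 1 / ln (r / rho t)))
    has_real_derivative
      - 2 * (P * ((\<alpha> - 2) * X) * D t * p t * p1 t + P * D t * (p1 t * p1 t + p t * p2))
      - (2 * p t * p1 t * (S * n t) * Z t * (q + l) + (p t)\<^sup>2 * (S * ((\<alpha> - 4 - 2 * \<gamma>) * X) * n t + S * n') * Z t * (q + l)
         + (p t)\<^sup>2 * (S * n t) * (c * (q + l) + Z t * (X * l\<^sup>2)))) (at t)"
    unfolding P_def S_def
    by (rule derivative_eq_intros pw p p1 n Z D L refl | simp add: l_def[symmetric])+
      (simp add: algebra_simps power2_eq_square)
  show ?thesis
    unfolding l_def[symmetric] S_def[symmetric] P_def[symmetric]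
    by (rule DERIV_cong[OF *[unfolded S_def[symmetric] l_def[symmetric] P_def[symmetric]]])
       (use SD e' d in algebra)
qed

text \<open>On a compact subset of the ball \<rho> has a maximum below r, so the logarithm stays
  away from 0; its blow-up at the origin only makes the reciprocal smaller.\<close>

lemma log_gauge_bounded:
  assumes "\<gamma> > 0" "r > 0" "compact K" "K \<subseteq> gball \<gamma> r"
  shows "bounded ((\<lambda>z. 1 / log_gauge \<gamma> r z) ` K)"
proof (cases "K = {}")
  case False
  obtain z0 where z0: "z0 \<in> K" "\<And>z. z \<in> K \<Longrightarrow> gauge \<gamma> z \<le> gauge \<gamma> z0"
    using continuous_attains_sup[OF assms(3) False continuous_on_subset[OF continuous_gauge[OF assms(1)]]] by auto
  \<comment> \<open>If the maximum of \<rho> on \<open>K\<close> is 0, any value strictly between 0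
    and r will do.\<close>
  define s where "s = (if gauge \<gamma> z0 > 0 then gauge \<gamma> z0 else r / 2)"
  have s: "0 < s" "s < r" using z0(1) assms by (auto simp: s_def gball_def)
  have "\<bar>1 / log_gauge \<gamma> r z\<bar> \<le> 1 / ln (r / s)" if "z \<in> K" for z
  proof (cases "gauge \<gamma> z = 0")
    case True
    \<comment> \<open>Default values at the origin: r / 0 = 0, ln 0 = 0 and 1 / 0 = 0.\<close>
    then show ?thesis using s by (simp add: log_gauge_def)
  next
    case False
    then have g: "0 < gauge \<gamma> z" using gauge_nonneg[of \<gamma> z] by simp
    then have le: "gauge \<gamma> z \<le> s" using z0(2)[OF that] by (auto simp: s_def)
    have "0 < ln (r / s)" using s by simp
    moreover have "ln (r / s) \<le> ln (r / gauge \<gamma> z)"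
      using s g le by (simp add: frac_le)
    ultimately show ?thesis by (simp add: log_gauge_def frac_le)
  qed
  then show ?thesis unfolding bounded_iff by (intro exI[of _ "1 / ln (r / s)"]) simp
qed simp

section \<open>Test functions supported in a compact \<open>K\<close>: integrability against the
  singular weights\<close>

context
  fixes \<gamma> \<alpha> r :: real and \<phi> :: "(real^'m) \<times> (real^'k) \<Rightarrow> real" and K
  assumes \<gamma>: "\<gamma> > 0" and \<alpha>: "\<alpha> - 4 > - Qdim \<gamma> TYPE('m) TYPE('k)" and r: "r > 0"
    and \<phi>: "smooth_fun \<phi>" and cK: "compact K" and Kr: "K \<subseteq> gball \<gamma> r"
    and supp: "{z. \<phi> z \<noteq> 0} \<subseteq> K"
begin

lemma off: "z \<notin> K \<Longrightarrow> \<phi> z = 0"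
  using supp by blast

lemma dirderiv_off:
  assumes "z \<notin> K"
  shows "dirderiv \<phi> b z = 0" "dirderiv (dirderiv \<phi> b) b' z = 0"
proof -
  have o: "open (- K)" using cK compact_imp_closed by blast
  have 1: "dirderiv \<phi> b z = 0" if "z \<notin> K" for z
    using dirderiv_eq_0_on_open[OF o] off that by simp
  show "dirderiv \<phi> b z = 0" by (rule 1[OF assms])
  show "dirderiv (dirderiv \<phi> b) b' z = 0"
    using dirderiv_eq_0_on_open[OF o] 1 assms by simp
qed

lemma integrable_weight:
  fixes w g :: "(real^'m) \<times> (real^'k) \<Rightarrow> real"
  assumes [measurable]: "w \<in> borel_measurable borel" "g \<in> borel_measurable borel"
    and g: "bounded (g ` K)" "\<And>z. z \<notin> K \<Longrightarrow> g z = 0"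
    and w: "\<And>z. z \<in> gball \<gamma> r \<Longrightarrow> \<bar>w z\<bar> \<le> B * gauge \<gamma> z powr (\<alpha> - 4)"
  shows "integrable lborel (\<lambda>z. w z * g z)"
proof -
  obtain A where A: "\<And>z. z \<in> K \<Longrightarrow> \<bar>g z\<bar> \<le> A"
    using g(1) unfolding bounded_iff by auto
  have "integrable lborel (\<lambda>z :: (real^'m) \<times> (real^'k). B * A * (indicator (gball \<gamma> r) z * gauge \<gamma> z powr (\<alpha> - 4)))"
    using gauge_powr_integrable[OF \<gamma> r, of "\<alpha> - 4", where 'm='m and 'k='k] \<alpha> by simp
  then show ?thesis
  proof (rule Bochner_Integration.integrable_bound)
    show "AE z in lborel. norm (w z * g z) \<le> norm (B * A * (indicator (gball \<gamma> r) z * gauge \<gamma> z powr (\<alpha> - 4)))"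
    proof (rule AE_I2)
      fix z
      show "norm (w z * g z) \<le> norm (B * A * (indicator (gball \<gamma> r) z * gauge \<gamma> z powr (\<alpha> - 4)))"
      proof (cases "z \<in> K")
        case True
        then have "\<bar>w z\<bar> * \<bar>g z\<bar> \<le> (B * gauge \<gamma> z powr (\<alpha> - 4)) * A"
          using A[OF True] w[of z] Kr by (intro mult_mono) (use order_trans[OF abs_ge_zero] in blast)+
        also have "\<dots> \<le> \<bar>B * gauge \<gamma> z powr (\<alpha> - 4) * A\<bar>" by simp
        finally show ?thesis using True Kr by (auto simp: abs_mult mult_ac)
      qed (simp add: g(2))
    qed
  qed measurable
qed

lemma integrable_sing_weight:
  assumes "g \<in> borel_measurable borel" "bounded (g ` K)" "\<And>z. z \<notin> K \<Longrightarrow> g z = 0"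
  shows "integrable lborel (\<lambda>z. sing_weight \<gamma> \<alpha> z * g z)"
proof (rule integrable_weight[OF measurable_sing_weight[OF \<gamma>] assms(1,2), where B=1])
  fix z
  show "\<bar>sing_weight \<gamma> \<alpha> z\<bar> \<le> 1 * gauge \<gamma> z powr (\<alpha> - 4)"
    using sing_weight_le[OF \<gamma>, of \<alpha> z] sing_weight_nonneg[of \<gamma> \<alpha> z] by simp
qed (fact assms)

text \<open>Inside the ball \<rho>^(\<alpha>-2) \<le> r^2 \<rho>^(\<alpha>-4), so this less singular
  weight is covered by the same condition on \<alpha>.\<close>

lemma integrable_gauge_weight:
  assumes "g \<in> borel_measurable borel" "bounded (g ` K)" "\<And>z. z \<notin> K \<Longrightarrow> g z = 0"
  shows "integrable lborel (\<lambda>z. gauge \<gamma> z powr (\<alpha> - 2) * g z)"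
proof (rule integrable_weight[OF _ assms(1,2)])
  have [measurable]: "\<gamma> > 0" by (fact \<gamma>)
  show "(\<lambda>z :: (real^'m) \<times> (real^'k). gauge \<gamma> z powr (\<alpha> - 2)) \<in> borel_measurable borel" by measurable
  fix z :: "(real^'m) \<times> (real^'k)" assume "z \<in> gball \<gamma> r"
  then have "gauge \<gamma> z < r" by (simp add: gball_def)
  then have "(gauge \<gamma> z)\<^sup>2 \<le> r\<^sup>2" using gauge_nonneg[of \<gamma> z] by (intro power_mono) auto
  moreover have "gauge \<gamma> z powr (\<alpha> - 2) = (gauge \<gamma> z)\<^sup>2 * gauge \<gamma> z powr (\<alpha> - 4)"
  proof (cases "gauge \<gamma> z = 0")
    case False
    then have "gauge \<gamma> z > 0" using gauge_nonneg[of \<gamma> z] by simp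
    then have "(gauge \<gamma> z)\<^sup>2 * gauge \<gamma> z powr (\<alpha> - 4) = gauge \<gamma> z powr 2 * gauge \<gamma> z powr (\<alpha> - 4)"
      by simp
    also have "\<dots> = gauge \<gamma> z powr (\<alpha> - 2)" by (simp only: powr_add[symmetric]) simp
    finally show ?thesis ..
  qed simp
  ultimately show "\<bar>gauge \<gamma> z powr (\<alpha> - 2)\<bar> \<le> r\<^sup>2 * gauge \<gamma> z powr (\<alpha> - 4)"
    by (simp add: mult_right_mono)
qed (fact assms)

section \<open>The flux along one abstract direction \<open>b\<close>, treating x- and y-coordinates
  alike\<close>

context
  fixes b and D Z R e d n' :: "(real^'m) \<times> (real^'k) \<Rightarrow> real" and c q :: real
  assumes D: "continuous_on UNIV D" and Z: "continuous_on UNIV Z"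
    and e: "e \<in> borel_measurable borel" "\<And>z. 0 \<le> e z \<and> e z \<le> 1"
    and d: "d \<in> borel_measurable borel" "\<And>z. 0 \<le> d z \<and> d z \<le> 1"
    and DERIV_gauge: "\<And>z. fst z \<noteq> 0 \<Longrightarrow> ((\<lambda>t. gauge \<gamma> (z + t *\<^sub>R b)) has_real_derivative R z) (at 0)"
    and DERIV_norm: "\<And>z. fst z \<noteq> 0 \<Longrightarrow>
       ((\<lambda>t. norm (fst (z + t *\<^sub>R b)) powr (2 * \<gamma>)) has_real_derivative n' z) (at 0)"
    and DERIV_Z: "\<And>z. fst z \<noteq> 0 \<Longrightarrow> ((\<lambda>t. Z (z + t *\<^sub>R b)) has_real_derivative c) (at 0)"
    and DERIV_D: "\<And>z. fst z \<noteq> 0 \<Longrightarrow> ((\<lambda>t. D (z + t *\<^sub>R b)) has_real_derivative 0) (at 0)"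
    and DR: "\<And>z. fst z \<noteq> 0 \<Longrightarrow> D z * R z * gauge \<gamma> z powr (1 + 2 * \<gamma>) = norm (fst z) powr (2 * \<gamma>) * Z z"
    and eR: "\<And>z. fst z \<noteq> 0 \<Longrightarrow> e z = Z z * R z / gauge \<gamma> z"
    and dn: "\<And>z. fst z \<noteq> 0 \<Longrightarrow> n' z * Z z = 2 * \<gamma> * norm (fst z) powr (2 * \<gamma>) * d z"
    and lines: "AE z in lborel. (\<forall>t. z + t *\<^sub>R b \<noteq> 0) \<and> finite {t. fst (z + t *\<^sub>R b) = 0}"
begin

lemma bounded_image_continuous: "continuous_on UNIV f \<Longrightarrow> bounded (f ` K)" for f :: "_ \<Rightarrow> real"
  using cK by (meson compact_continuous_image compact_imp_bounded continuous_on_subset top_greatest)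

lemma continuous_derivs:
  "continuous_on S \<phi>" "continuous_on S (dirderiv \<phi> b)" "continuous_on S (dirderiv (dirderiv \<phi> b) b)"
  using \<phi> by (auto intro!: smooth_fun_continuous smooth_fun_dirderiv)

lemma measurable_derivs:
  "\<phi> \<in> borel_measurable borel" "dirderiv \<phi> b \<in> borel_measurable borel" 
  "dirderiv (dirderiv \<phi> b) b \<in> borel_measurable borel"
  "D \<in> borel_measurable borel" "Z \<in> borel_measurable borel"
  using continuous_derivs D Z by (auto intro!: borel_measurable_continuous_onI)

lemmas bounded_intros = bounded_image_mult bounded_plus_comp bounded_minus_comp
  log_gauge_bounded[OF \<gamma> r cK Kr] bounded_image_continuous continuous_derivs D Z continuous_on_const

lemma bounded_ed: "bounded (e ` K)" "bounded (d ` K)"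
  using e(2) d(2) unfolding bounded_iff by (auto intro!: exI[of _ 1])

lemma integrable_flux_deriv: "integrable lborel (flux_deriv \<gamma> \<alpha> r q \<phi> b D Z c e d)"
  unfolding flux_deriv_def
proof (intro Bochner_Integration.integrable_add integrable_gauge_weight integrable_sing_weight)
  note [measurable] = \<gamma> e(1) d(1) measurable_derivs
  show "(\<lambda>z. - 2 * (D z * ((dirderiv \<phi> b z)\<^sup>2 + \<phi> z * dirderiv (dirderiv \<phi> b) b z))) \<in> borel_measurable borel"
    by measurable
  show "(\<lambda>z. - 2 * (\<phi> z * dirderiv \<phi> b z * Z z * (\<alpha> - 2 + q + 1 / log_gauge \<gamma> r z))
        - (\<phi> z)\<^sup>2 * ((q + 1 / log_gauge \<gamma> r z) * (c + (\<alpha> - 4 - 2 * \<gamma>) * e z + 2 * \<gamma> * d z)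
            + e z * (1 / log_gauge \<gamma> r z)\<^sup>2)) \<in> borel_measurable borel"
    by measurable
  show "bounded ((\<lambda>z. - 2 * (D z * ((dirderiv \<phi> b z)\<^sup>2 + \<phi> z * dirderiv (dirderiv \<phi> b) b z))) ` K)"
    unfolding power2_eq_square by (intro bounded_intros)
  show "bounded ((\<lambda>z. - 2 * (\<phi> z * dirderiv \<phi> b z * Z z * (\<alpha> - 2 + q + 1 / log_gauge \<gamma> r z))
        - (\<phi> z)\<^sup>2 * ((q + 1 / log_gauge \<gamma> r z) * (c + (\<alpha> - 4 - 2 * \<gamma>) * e z + 2 * \<gamma> * d z)
            + e z * (1 / log_gauge \<gamma> r z)\<^sup>2)) ` K)"
    unfolding power2_eq_square by (intro bounded_intros bounded_ed)
qed (simp_all add: off dirderiv_off)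

lemma integrable_flux: "integrable lborel (flux \<gamma> \<alpha> r q \<phi> b D Z)"
proof -
  note [measurable] = \<gamma> measurable_derivs
  have "integrable lborel (\<lambda>z. gauge \<gamma> z powr (\<alpha> - 2) * (- 2 * D z * \<phi> z * dirderiv \<phi> b z)
    + sing_weight \<gamma> \<alpha> z * (- 1 * (\<phi> z * \<phi> z) * Z z * (q + 1 / log_gauge \<gamma> r z)))"
  proof (intro Bochner_Integration.integrable_add integrable_gauge_weight integrable_sing_weight)
    show "(\<lambda>z. - 2 * D z * \<phi> z * dirderiv \<phi> b z) \<in> borel_measurable borel" by measurable
    show "(\<lambda>z. - 1 * (\<phi> z * \<phi> z) * Z z * (q + 1 / log_gauge \<gamma> r z)) \<in> borel_measurable borel" by measurable
    show "bounded ((\<lambda>z. - 2 * D z * \<phi> z * dirderiv \<phi> b z) ` K)" by (intro bounded_intros)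
    show "bounded ((\<lambda>z. - 1 * (\<phi> z * \<phi> z) * Z z * (q + 1 / log_gauge \<gamma> r z)) ` K)" by (intro bounded_intros)
  qed (simp_all add: off)
  then show ?thesis
    by (rule back_subst[where P="integrable lborel"]) (auto simp: flux_def power2_eq_square)
qed

text \<open>Outside \<open>K\<close> the logarithm may vanish (on \<rho> = r), so regularity cannot
  be read off the formula for the flux; local vanishing takes its place.\<close>

lemma eventually_flux_eq_0:
  assumes "z \<notin> K"
  shows "eventually (\<lambda>w. flux \<gamma> \<alpha> r q \<phi> b D Z w = 0) (nhds z)"
proof -
  have "open (- K)" using cK compact_imp_closed by blast
  then have "eventually (\<lambda>w. w \<in> - K) (nhds z)" using assms by (intro eventually_nhds_in_open) auto
  then show ?thesis by eventually_elim (simp add: flux_def off)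
qed

text \<open>Points with x = 0 and y nonzero are included: |x|^(2\<gamma>) is continuous there since
  \<gamma> > 0, although its derivative may fail to exist.\<close>

lemma isCont_flux:
  assumes "z \<noteq> 0"
  shows "isCont (flux \<gamma> \<alpha> r q \<phi> b D Z) z"
proof (cases "z \<in> K")
  case False
  then show ?thesis
    using eventually_flux_eq_0[OF False] by (subst isCont_cong[where g="\<lambda>_. 0"]) auto
next
  case True
  have g: "0 < gauge \<gamma> z" "gauge \<gamma> z < r" 
    using gauge_pos_iff[OF \<gamma>, of z] assms True Kr by (auto simp: gball_def)
  have c: "isCont f z" if "continuous_on UNIV f" for f :: "_ \<Rightarrow> real"
    using that continuous_on_eq_continuous_at[of UNIV f] by blast
  have n: "continuous_on UNIV (\<lambda>z :: (real^'m) \<times> (real^'k). norm (fst z) powr (2 * \<gamma>))"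
    using \<gamma> by (intro continuous_on_powr' continuous_intros) auto
  note c = c[OF n] c[OF continuous_derivs(1)] c[OF continuous_derivs(2)] c[OF D] c[OF Z] c[OF continuous_gauge[OF \<gamma>]]
  show ?thesis
    unfolding flux_def sing_weight_def log_gauge_def
    by (intro c continuous_intros) (use g in auto)
qed

lemma DERIV_flux:
  assumes "fst z \<noteq> 0"
  shows "((\<lambda>t. flux \<gamma> \<alpha> r q \<phi> b D Z (z + t *\<^sub>R b)) has_real_derivative flux_deriv \<gamma> \<alpha> r q \<phi> b D Z c e d z) (at 0)"
proof (cases "z \<in> K")
  case False
  have "((\<lambda>t::real. z + t *\<^sub>R b) \<longlongrightarrow> z) (nhds 0)"
    by (auto intro!: tendsto_eq_intros filterlim_ident)
  then have ev: "eventually (\<lambda>t. flux \<gamma> \<alpha> r q \<phi> b D Z (z + t *\<^sub>R b) = 0) (nhds 0)"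
    using eventually_flux_eq_0[OF False] by (rule eventually_compose_filterlim[rotated])
  have "flux_deriv \<gamma> \<alpha> r q \<phi> b D Z c e d z = 0"
    by (simp add: flux_deriv_def off[OF False] dirderiv_off[OF False])
  then show ?thesis
    using DERIV_cong_ev[OF refl ev refl] by simp
next
  case True
  have g: "0 < gauge \<gamma> z" "gauge \<gamma> z < r" 
    using gauge_pos_iff[OF \<gamma>, of z] assms True Kr by (auto simp: gball_def)
  have diff: "\<phi> differentiable (at z)" "dirderiv \<phi> b differentiable (at z)"
    using \<phi> by (auto intro: smooth_fun_differentiable smooth_fun_dirderiv)
  show ?thesis
    unfolding flux_def flux_deriv_def sing_weight_def log_gauge_def
    using DERIV_flux_1d[where p="\<lambda>t. \<phi> (z + t *\<^sub>R b)" and ?p1.0="\<lambda>t. dirderiv \<phi> b (z + t *\<^sub>R b)"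
        and rho="\<lambda>t. gauge \<gamma> (z + t *\<^sub>R b)" and n="\<lambda>t. norm (fst (z + t *\<^sub>R b)) powr (2 * \<gamma>)"
        and Z="\<lambda>t. Z (z + t *\<^sub>R b)" and D="\<lambda>t. D (z + t *\<^sub>R b)" and t=0,
      unfolded scaleR_zero_left add_0_right,
      OF DERIV_line_dirderiv[OF diff(1)] DERIV_line_dirderiv[OF diff(2)]
      DERIV_gauge[OF assms] DERIV_norm[OF assms] DERIV_Z[OF assms] DERIV_D[OF assms], of r \<gamma> "e z" "d z" \<alpha> q]
      g DR[OF assms] eR[OF assms] dn[OF assms] by simp
qed

text \<open>Almost every line in direction \<open>b\<close> avoids the origin, so the flux is
  continuous along it, and it meets x = 0 in a finite set, which serves as the exceptional set for
  differentiability.\<close>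

lemma integral_flux_deriv: "(LINT z|lborel. flux_deriv \<gamma> \<alpha> r q \<phi> b D Z c e d z) = 0"
proof (rule integral_directional_derivative_eq_0[OF integrable_flux integrable_flux_deriv, of b])
  show "AE z in lborel. \<exists>E. finite E 
      \<and> continuous_on {0..1} (\<lambda>t. flux \<gamma> \<alpha> r q \<phi> b D Z (z + t *\<^sub>R b))
      \<and> (\<forall>t. t \<notin> E \<longrightarrow> ((\<lambda>t. flux \<gamma> \<alpha> r q \<phi> b D Z (z + t *\<^sub>R b)) has_real_derivative
            flux_deriv \<gamma> \<alpha> r q \<phi> b D Z c e d (z + t *\<^sub>R b)) (at t))"
    using lines
  proof eventually_elim
    case (elim z)
    have "continuous_on {0..1} (\<lambda>t. flux \<gamma> \<alpha> r q \<phi> b D Z (z + t *\<^sub>R b))"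
      using elim by (intro continuous_at_imp_continuous_on ballI isCont_o2[OF _ isCont_flux]) 
        (auto intro!: continuous_intros)
    then show ?case
      using elim DERIV_line_shift[OF DERIV_flux] by (intro exI[of _ "{t. fst (z + t *\<^sub>R b) = 0}"]) auto
  qed
qed

end

end

subsection \<open>Coordinate directions\<close>

lemma DERIV_norm_line:
  fixes x u :: "'a::real_inner"
  assumes "x \<noteq> 0"
  shows "((\<lambda>t. norm (x + t *\<^sub>R u) powr p) has_real_derivative p * norm x powr (p - 2) * (x \<bullet> u)) (at 0)"
proof -
  have "((\<lambda>t::real. x + t *\<^sub>R u) has_derivative (\<lambda>t. t *\<^sub>R u)) (at 0)"
    by (auto intro!: derivative_eq_intros)
  moreover have "(norm has_derivative (\<lambda>h. h \<bullet> sgn x)) (at (x + 0 *\<^sub>R u))"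
    using has_derivative_norm[OF assms] by simp
  ultimately have "((norm \<circ> (\<lambda>t. x + t *\<^sub>R u)) has_derivative ((\<lambda>h. h \<bullet> sgn x) \<circ> (\<lambda>t. t *\<^sub>R u))) (at 0)"
    by (rule diff_chain_at)
  then have 1: "((\<lambda>t. norm (x + t *\<^sub>R u)) has_real_derivative (x \<bullet> u) / norm x) (at 0)"
    by (simp add: o_def has_field_derivative_def sgn_div_norm inner_commute divide_inverse mult_commute_abs mult_ac)
  show ?thesis
    using assms
    by (auto intro!: derivative_eq_intros 1 simp: powr_diff power2_eq_square field_simps)
qed

lemma DERIV_gauge_line:
  fixes z b :: "(real^'m) \<times> (real^'k)"
  assumes "\<gamma> > 0" "fst z \<noteq> 0"
  shows "((\<lambda>t. gauge \<gamma> (z + t *\<^sub>R b)) has_real_derivative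
    gauge \<gamma> z powr (- 1 - 2 * \<gamma>) * (norm (fst z) powr (2 * \<gamma>) * (fst z \<bullet> fst b) + (1 + \<gamma>) * (snd z \<bullet> snd b))) (at 0)"
proof -
  let ?A = "\<lambda>t. norm (fst z + t *\<^sub>R fst b) powr (2 * (1 + \<gamma>)) + (1 + \<gamma>)\<^sup>2 * (norm (snd z + t *\<^sub>R snd b))\<^sup>2"
  let ?A' = "2 * (1 + \<gamma>) * (norm (fst z) powr (2 * \<gamma>) * (fst z \<bullet> fst b) + (1 + \<gamma>) * (snd z \<bullet> snd b))"
  have z: "z \<noteq> 0" using assms(2) by auto
  have g: "0 < gauge \<gamma> z" using gauge_pos_iff[OF assms(1), of z] z by simp
  have A0: "?A 0 = gauge \<gamma> z powr (2 * (1 + \<gamma>))"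
    using gauge_powr[OF assms(1), of z] by simp
  have "((\<lambda>t. (snd z + t *\<^sub>R snd b) \<bullet> (snd z + t *\<^sub>R snd b)) has_real_derivative 2 * (snd z \<bullet> snd b)) (at 0)"
    unfolding has_field_derivative_def by (auto intro!: derivative_eq_intros simp: inner_commute)
  then have n2: "((\<lambda>t. (norm (snd z + t *\<^sub>R snd b))\<^sup>2) has_real_derivative 2 * (snd z \<bullet> snd b)) (at 0)"
    by (simp add: power2_norm_eq_inner)
  have A: "(?A has_real_derivative ?A') (at 0)"
    by (rule derivative_eq_intros DERIV_norm_line[OF assms(2)] n2 refl)+
      (simp add: algebra_simps power2_eq_square)
  have "((\<lambda>t. ?A t powr (1 / (2 * (1 + \<gamma>)))) has_real_derivative
     (1 / (2 * (1 + \<gamma>))) * ?A 0 powr (1 / (2 * (1 + \<gamma>)) - 1) * ?A') (at 0)"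
    using DERIV_fun_powr[OF A, of "1 / (2 * (1 + \<gamma>))"] A0 g unfolding of_nat_1 by fastforce
  also have "(1 / (2 * (1 + \<gamma>))) * ?A 0 powr (1 / (2 * (1 + \<gamma>)) - 1) * ?A' 
    = ?A 0 powr (1 / (2 * (1 + \<gamma>)) - 1) * (?A' / (2 * (1 + \<gamma>)))" by simp
  also have "?A 0 powr (1 / (2 * (1 + \<gamma>)) - 1) = gauge \<gamma> z powr (- 1 - 2 * \<gamma>)"
  proof -
    have "2 * (1 + \<gamma>) * (1 / (2 * (1 + \<gamma>)) - 1) = - 1 - 2 * \<gamma>"
      using assms(1) by (simp only: right_diff_distrib) (simp add: field_simps)
    then show ?thesis unfolding A0 powr_powr by simp
  qed
  also have "?A' / (2 * (1 + \<gamma>)) = norm (fst z) powr (2 * \<gamma>) * (fst z \<bullet> fst b) + (1 + \<gamma>) * (snd z \<bullet> snd b)"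
    using assms(1) by simp
  finally show ?thesis by (simp add: gauge_def)
qed

lemma gauge_factor:
  assumes "\<gamma> > 0" "z \<noteq> 0"
  shows "gauge \<gamma> z powr (- 1 - 2 * \<gamma>) * gauge \<gamma> z powr (1 + 2 * \<gamma>) = 1"
    and "gauge \<gamma> z powr (- 1 - 2 * \<gamma>) / gauge \<gamma> z = gauge \<gamma> z powr (- 2 - 2 * \<gamma>)"
    and "gauge \<gamma> z powr (- 2 - 2 * \<gamma>) * gauge \<gamma> z powr (2 * (1 + \<gamma>)) = 1"
proof -
  have g: "0 < gauge \<gamma> z" using gauge_pos_iff[OF assms(1), of z] assms by simp
  show "gauge \<gamma> z powr (- 1 - 2 * \<gamma>) * gauge \<gamma> z powr (1 + 2 * \<gamma>) = 1"
    "gauge \<gamma> z powr (- 2 - 2 * \<gamma>) * gauge \<gamma> z powr (2 * (1 + \<gamma>)) = 1"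
    using g by (simp_all add: powr_add[symmetric])
  have "gauge \<gamma> z powr (- 2 - 2 * \<gamma>) = gauge \<gamma> z powr ((- 1 - 2 * \<gamma>) - 1)" by simp
  also have "\<dots> = gauge \<gamma> z powr (- 1 - 2 * \<gamma>) / gauge \<gamma> z"
    using g by (simp only: powr_diff powr_one)
  finally show "gauge \<gamma> z powr (- 1 - 2 * \<gamma>) / gauge \<gamma> z = gauge \<gamma> z powr (- 2 - 2 * \<gamma>)" ..
qed

lemma finite_affine_zeros:
  fixes a b :: real assumes "b \<noteq> 0"
  shows "finite {t. a + t * b = 0}"
  by (rule finite_subset[of _ "{- a / b}"]) (use assms in \<open>auto simp: field_simps\<close>)

text \<open>The fractions of \<open>Z\<rho> = \<rho>\<close> and of \<open>Z|x| = |x|\<close> contributed by single coordinates.\<close>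

definition x_share :: "real \<Rightarrow> 'm \<Rightarrow> (real^'m) \<times> (real^'k) \<Rightarrow> real" where
  "x_share \<gamma> i z = norm (fst z) powr (2 * \<gamma>) * (fst z $ i)\<^sup>2 * gauge \<gamma> z powr (- 2 - 2 * \<gamma>)"

definition y_share :: "real \<Rightarrow> 'k \<Rightarrow> (real^'m) \<times> (real^'k) \<Rightarrow> real" where
  "y_share \<gamma> j z = ((1 + \<gamma>) * (snd z $ j))\<^sup>2 * gauge \<gamma> z powr (- 2 - 2 * \<gamma>)"

definition radial_share :: "'m \<Rightarrow> (real^'m) \<times> (real^'k) \<Rightarrow> real" where
  "radial_share i z = (fst z $ i)\<^sup>2 / (norm (fst z))\<^sup>2"

lemma norm_vec_sum: "(norm (x :: real^'n))\<^sup>2 = (\<Sum>i\<in>UNIV. (x $ i)\<^sup>2)"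
  by (simp add: norm_vec_def L2_set_def sum_nonneg)

lemma norm_powr_square:
  assumes "\<gamma> > 0"
  shows "norm x powr (2 * \<gamma>) * (norm x)\<^sup>2 = norm x powr (2 * (1 + \<gamma>))"
proof (cases "norm x = 0")
  case False
  then have "(norm x)\<^sup>2 = norm x powr 2" by simp
  then show ?thesis by (simp only: powr_add[symmetric]) (simp add: algebra_simps)
qed (use assms in simp)

lemma sum_radial_share: "fst z \<noteq> 0 \<Longrightarrow> (\<Sum>i\<in>UNIV. radial_share i z) = 1"
  by (simp add: radial_share_def sum_divide_distrib[symmetric] norm_vec_sum[symmetric])

text \<open>Multiplied by \<rho>^(2(1+\<gamma>)), this is the defining equation of the gauge; it is
  Euler's identity Z\<rho> = \<rho> divided by \<rho>.\<close>

lemma sum_shares: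
  assumes "\<gamma> > 0" "z \<noteq> 0"
  shows "(\<Sum>i\<in>UNIV. x_share \<gamma> i z) + (\<Sum>j\<in>UNIV. y_share \<gamma> j z) = 1"
proof -
  have "(\<Sum>i\<in>UNIV. x_share \<gamma> i z) + (\<Sum>j\<in>UNIV. y_share \<gamma> j z)
    = (norm (fst z) powr (2 * \<gamma>) * (norm (fst z))\<^sup>2 + (1 + \<gamma>)\<^sup>2 * (norm (snd z))\<^sup>2) * gauge \<gamma> z powr (- 2 - 2 * \<gamma>)"
    unfolding distrib_right[of "_ * _"]
    by (simp add: x_share_def y_share_def norm_vec_sum sum_distrib_left sum_distrib_right power_mult_distrib)
  then show ?thesis
    unfolding norm_powr_square[OF assms(1)] gauge_powr[OF assms(1), symmetric]
    using gauge_factor(3)[OF assms] by (simp add: mult.commute)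
qed

lemma shares_nonneg: "0 \<le> x_share \<gamma> i z" "0 \<le> y_share \<gamma> j z" "0 \<le> radial_share i z"
  by (auto simp: x_share_def y_share_def radial_share_def)

lemma shares_le_1:
  assumes "\<gamma> > 0"
  shows "x_share \<gamma> i z \<le> 1" "y_share \<gamma> j z \<le> 1" "radial_share i z \<le> 1"
proof -
  have m: "x_share \<gamma> i z \<le> (\<Sum>i\<in>UNIV. x_share \<gamma> i z)" "y_share \<gamma> j z \<le> (\<Sum>j\<in>UNIV. y_share \<gamma> j z)"
    "radial_share i z \<le> (\<Sum>i\<in>UNIV. radial_share i z)"
    "0 \<le> (\<Sum>i\<in>UNIV. x_share \<gamma> i z)" "0 \<le> (\<Sum>j\<in>UNIV. y_share \<gamma> j z)"
    by (auto intro!: member_le_sum sum_nonneg shares_nonneg)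
  show "x_share \<gamma> i z \<le> 1"
  proof (cases "z = 0")
    case False then show ?thesis using m sum_shares[OF assms False] by linarith
  qed (simp add: x_share_def)
  show "y_share \<gamma> j z \<le> 1"
  proof (cases "z = 0")
    case False then show ?thesis using m sum_shares[OF assms False] by linarith
  qed (simp add: y_share_def)
  show "radial_share i z \<le> 1"
  proof (cases "fst z = 0")
    case False then show ?thesis using m sum_radial_share[OF False] by linarith
  qed (simp add: radial_share_def)
qed

lemma measurable_vec_nth_borel [measurable]: "(\<lambda>x :: real^'n. x $ i) \<in> borel_measurable borel"
  by (intro borel_measurable_continuous_onI continuous_intros)

lemma measurable_shares:
  fixes \<gamma> :: real
  assumes [measurable]: "\<gamma> > 0"
  shows "(x_share \<gamma> i :: (real^'m) \<times> (real^'k) \<Rightarrow> real) \<in> borel_measurable borel"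
    "(y_share \<gamma> j :: (real^'m) \<times> (real^'k) \<Rightarrow> real) \<in> borel_measurable borel"
    "(radial_share i :: (real^'m) \<times> (real^'k) \<Rightarrow> real) \<in> borel_measurable borel"
  unfolding x_share_def y_share_def radial_share_def by measurable

context
  fixes \<gamma> \<alpha> r :: real and \<phi> :: "(real^'m) \<times> (real^'k) \<Rightarrow> real" and K
  assumes \<gamma>: "\<gamma> > 0" and \<alpha>: "\<alpha> - 4 > - Qdim \<gamma> TYPE('m) TYPE('k)" and r: "r > 0"
    and \<phi>: "smooth_fun \<phi>" and cK: "compact K" and Kr: "K \<subseteq> gball \<gamma> r"
    and supp: "{z. \<phi> z \<noteq> 0} \<subseteq> K"
begin

text \<open>In both families the second-order coefficient is constant along its own direction, since
  |x| does not depend on y. The values of \<open>c\<close>, namely 1 for each x-coordinate and 1 +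
  \<gamma> for each y-coordinate, add up to Q.\<close>

abbreviation "x_flux_deriv q i \<equiv> flux_deriv \<gamma> \<alpha> r q \<phi> (axis i 1, 0) (\<lambda>_. 1) (\<lambda>z. fst z $ i) 1
  (x_share \<gamma> i) (radial_share i)"

abbreviation "y_flux_deriv q j \<equiv> flux_deriv \<gamma> \<alpha> r q \<phi> (0, axis j 1) (\<lambda>z. norm (fst z) powr (2 * \<gamma>))
  (\<lambda>z. (1 + \<gamma>) * snd z $ j) (1 + \<gamma>) (y_share \<gamma> j) (\<lambda>_. 0)"

lemma x_flux_deriv:
  "integrable lborel (x_flux_deriv q i)" "(LINT z|lborel. x_flux_deriv q i z) = 0"
proof -
  let ?b = "(axis i 1, 0) :: (real^'m) \<times> (real^'k)"
  let ?n' = "\<lambda>z :: (real^'m) \<times> (real^'k). 2 * \<gamma> * norm (fst z) powr (2 * \<gamma> - 2) * fst z $ i"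
  let ?R = "\<lambda>z :: (real^'m) \<times> (real^'k). gauge \<gamma> z powr (- 1 - 2 * \<gamma>) * (norm (fst z) powr (2 * \<gamma>) * fst z $ i)"
  have cont: "continuous_on UNIV (\<lambda>_::(real^'m) \<times> (real^'k). 1::real)"
    "continuous_on UNIV (\<lambda>z::(real^'m) \<times> (real^'k). fst z $ i)" by (intro continuous_intros)+
  have share: "0 \<le> x_share \<gamma> i z \<and> x_share \<gamma> i z \<le> 1" "0 \<le> radial_share i z \<and> radial_share i z \<le> 1" for z :: "(real^'m) \<times> (real^'k)"
    by (simp_all add: shares_nonneg shares_le_1[OF \<gamma>])
  have dg: "((\<lambda>t. gauge \<gamma> (z + t *\<^sub>R ?b)) has_real_derivative ?R z) (at 0)" if "fst z \<noteq> 0" for z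
    using DERIV_gauge_line[OF \<gamma> that, of ?b] by (simp add: inner_axis)
  have dn: "((\<lambda>t. norm (fst (z + t *\<^sub>R ?b)) powr (2 * \<gamma>)) has_real_derivative ?n' z) (at 0)" if "fst z \<noteq> 0" for z
    using DERIV_norm_line[OF that, of "axis i 1" "2 * \<gamma>"] by (simp add: inner_axis)
  have dZ: "((\<lambda>t. fst (z + t *\<^sub>R ?b) $ i) has_real_derivative 1) (at 0)" if "fst z \<noteq> 0" for z :: "(real^'m) \<times> (real^'k)"
    by (auto intro!: derivative_eq_intros)
  have dD: "((\<lambda>t::real. 1::real) has_real_derivative 0) (at 0)" if "fst z \<noteq> 0" for z :: "(real^'m) \<times> (real^'k)"
    by simp
  have nn: "?n' z * fst z $ i = 2 * \<gamma> * norm (fst z) powr (2 * \<gamma>) * radial_share i z" if "fst z \<noteq> 0" for z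
    using that by (simp add: radial_share_def powr_diff power2_eq_square)
  have e: "x_share \<gamma> i z = fst z $ i * ?R z / gauge \<gamma> z" if "fst z \<noteq> 0" for z
  proof -
    have "z \<noteq> 0" using that by auto
    then show ?thesis
      by (simp add: x_share_def gauge_factor(2)[OF \<gamma>, symmetric] power2_eq_square)
  qed
  have DR: "1 * ?R z * gauge \<gamma> z powr (1 + 2 * \<gamma>) = norm (fst z) powr (2 * \<gamma>) * fst z $ i" if "fst z \<noteq> 0" for z
  proof -
    have "z \<noteq> 0" using that by auto
    then have "gauge \<gamma> z powr (- 1 - 2 * \<gamma>) * gauge \<gamma> z powr (1 + 2 * \<gamma>) = 1" by (rule gauge_factor(1)[OF \<gamma>])
    then show ?thesis by algebra
  qed
  \<comment> \<open>A line in an x-direction keeps y fixed, so it can hit the origin only if y = 0,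
    a null set because k \<ge> 1. It meets x = 0 at most once, as its i-th coordinate is a
    nonconstant affine function.\<close>
  obtain j :: 'k where True by simp
  have "(0, axis j 1) \<in> (Basis :: ((real^'m) \<times> (real^'k)) set)" by (simp add: Basis_prod_def axis_in_Basis_iff)
  from AE_lborel_inner_neq[OF this, of 0]
  have lines: "AE z in lborel. (\<forall>t. z + t *\<^sub>R ?b \<noteq> 0) \<and> finite {t. fst (z + t *\<^sub>R ?b) = 0}"
  proof eventually_elim
    case (elim z)
    then have "snd z \<noteq> 0" by (auto simp: inner_prod_def)
    moreover have "{t. fst (z + t *\<^sub>R ?b) = 0} \<subseteq> {t. fst z $ i + t * 1 = 0}"
      by (auto simp: vec_eq_iff dest!: spec[of _ i])
    ultimately show ?case
      using finite_affine_zeros[of 1 "fst z $ i"] finite_subset by (auto simp: prod_eq_iff)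
  qed
  note facts = \<gamma> \<alpha> r \<phi> cK Kr supp cont measurable_shares(1)[OF \<gamma>] share(1) measurable_shares(3)[OF \<gamma>] share(2) 
    dg dn dZ dD DR e nn lines
  show "integrable lborel (x_flux_deriv q i)"
    by (rule integrable_flux_deriv) (fact facts)+
  show "(LINT z|lborel. x_flux_deriv q i z) = 0"
    by (rule integral_flux_deriv) (fact facts)+
qed

lemma y_flux_deriv:
  "integrable lborel (y_flux_deriv q j)" "(LINT z|lborel. y_flux_deriv q j z) = 0"
proof -
  let ?b = "(0, axis j 1) :: (real^'m) \<times> (real^'k)"
  let ?R = "\<lambda>z :: (real^'m) \<times> (real^'k). gauge \<gamma> z powr (- 1 - 2 * \<gamma>) * ((1 + \<gamma>) * snd z $ j)"
  have cont: "continuous_on UNIV (\<lambda>z::(real^'m) \<times> (real^'k). norm (fst z) powr (2 * \<gamma>))"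
    "continuous_on UNIV (\<lambda>z::(real^'m) \<times> (real^'k). (1 + \<gamma>) * snd z $ j)"
    using \<gamma> by (intro continuous_intros continuous_on_powr'; simp)+
  have share: "0 \<le> y_share \<gamma> j z \<and> y_share \<gamma> j z \<le> 1" "0 \<le> (0::real) \<and> 0 \<le> (1::real)" for z :: "(real^'m) \<times> (real^'k)"
    by (simp_all add: shares_nonneg shares_le_1[OF \<gamma>])
  have dg: "((\<lambda>t. gauge \<gamma> (z + t *\<^sub>R ?b)) has_real_derivative ?R z) (at 0)" if "fst z \<noteq> 0" for z
    using DERIV_gauge_line[OF \<gamma> that, of ?b] by (simp add: inner_axis)
  have dn: "((\<lambda>t. norm (fst (z + t *\<^sub>R ?b)) powr (2 * \<gamma>)) has_real_derivative 0) (at 0)" if "fst z \<noteq> 0" for z :: "(real^'m) \<times> (real^'k)"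
    by simp
  have dZ: "((\<lambda>t. (1 + \<gamma>) * snd (z + t *\<^sub>R ?b) $ j) has_real_derivative (1 + \<gamma>)) (at 0)" if "fst z \<noteq> 0" for z :: "(real^'m) \<times> (real^'k)"
    by (auto intro!: derivative_eq_intros)
  have nn: "0 * ((1 + \<gamma>) * snd z $ j) = 2 * \<gamma> * norm (fst z) powr (2 * \<gamma>) * 0"
    if "fst z \<noteq> 0" for z :: "(real^'m) \<times> (real^'k)"
    by simp
  have e: "y_share \<gamma> j z = (1 + \<gamma>) * snd z $ j * ?R z / gauge \<gamma> z" if "fst z \<noteq> 0" for z
  proof -
    have "z \<noteq> 0" using that by auto
    then show ?thesis
      by (simp add: y_share_def gauge_factor(2)[OF \<gamma>, symmetric] power2_eq_square)
  qed
  have DR: "norm (fst z) powr (2 * \<gamma>) * ?R z * gauge \<gamma> z powr (1 + 2 * \<gamma>) = norm (fst z) powr (2 * \<gamma>) * ((1 + \<gamma>) * snd z $ j)"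
    if "fst z \<noteq> 0" for z
  proof -
    have "z \<noteq> 0" using that by auto
    then have "gauge \<gamma> z powr (- 1 - 2 * \<gamma>) * gauge \<gamma> z powr (1 + 2 * \<gamma>) = 1" by (rule gauge_factor(1)[OF \<gamma>])
    then show ?thesis by algebra
  qed
  \<comment> \<open>A line in a y-direction keeps x fixed. Since m \<ge> 1, almost every such line
    has x nonzero and never meets the singular set.\<close>
  obtain i :: 'm where True by simp
  have "(axis i 1, 0) \<in> (Basis :: ((real^'m) \<times> (real^'k)) set)" by (simp add: Basis_prod_def axis_in_Basis_iff)
  from AE_lborel_inner_neq[OF this, of 0]
  have lines: "AE z in lborel. (\<forall>t. z + t *\<^sub>R ?b \<noteq> 0) \<and> finite {t. fst (z + t *\<^sub>R ?b) = 0}"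
  proof eventually_elim
    case (elim z)
    then have "fst z \<noteq> 0" by (auto simp: inner_prod_def)
    then show ?case by (auto simp: prod_eq_iff)
  qed
  note facts = \<gamma> \<alpha> r \<phi> cK Kr supp cont measurable_shares(2)[OF \<gamma>] share(1) share(2) 
    dg dn dZ dn DR e nn lines borel_measurable_const
  show "integrable lborel (y_flux_deriv q j)"
    by (rule integrable_flux_deriv[where n'="\<lambda>_. 0"]) (fact facts)+
  show "(LINT z|lborel. y_flux_deriv q j z) = 0"
    by (rule integral_flux_deriv[where n'="\<lambda>_. 0"]) (fact facts)+
qed

end

subsection \<open>The Rellich inequality\<close>

lemma sum_flux_terms:
  fixes p s w e d :: "'a \<Rightarrow> real"
  assumes "finite A"
  shows "(\<Sum>i\<in>A. P * (- 2 * (D * ((p i)\<^sup>2 + f * s i)))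
       + S * (- 2 * (f * p i * w i * T) - f\<^sup>2 * (M * (c + \<kappa> * e i + g * d i) + e i * l)))
    = P * (- 2 * (D * (\<Sum>i\<in>A. (p i)\<^sup>2) + f * (D * (\<Sum>i\<in>A. s i))))
       + S * (- 2 * (f * (\<Sum>i\<in>A. w i * p i) * T)
         - f\<^sup>2 * (M * (c * real (card A) + \<kappa> * (\<Sum>i\<in>A. e i) + g * (\<Sum>i\<in>A. d i)) + (\<Sum>i\<in>A. e i) * l))"
  using assms by (induction A rule: finite_induct) (simp_all add: algebra_simps)

text \<open>Three squares: the first one splits off \<open>\<phi> \<Delta>\<phi>\<close>, the hypothesis \<open>E\<close> is the Cauchy-Schwarz
  inequality between \<open>Z\<phi>\<close> and the gradient, and the last one absorbs the cross term \<open>\<phi> Z\<phi>\<close>.\<close>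

lemma rellich_pointwise:
  fixes P S :: real
  assumes S: "S > 0" and E: "S * E\<^sup>2 \<le> P * G" and "C \<ge> 0" and C: "C = (Q + \<alpha> - 4) * (Q - \<alpha>) / 4"
  shows "C * (P * (- 2 * (G + f * W)) + S * (- 2 * (f * E * (\<alpha> - 2 + (Q - 2) + l))
       - f\<^sup>2 * ((Q - 2 + l) * (Q + \<alpha> - 4) + l\<^sup>2)))
     + (C\<^sup>2 * (S * f\<^sup>2) + C / 2 * (S * f\<^sup>2 * l\<^sup>2)) \<le> P\<^sup>2 / S * W\<^sup>2"
proof -
  define T where "T = Q + \<alpha> - 4 + l"
  have 1: "P\<^sup>2 / S * W\<^sup>2 \<ge> - 2 * C * P * f * W - C\<^sup>2 * S * f\<^sup>2"
  proof -
    \<comment> \<open>Completing the square with the optimal multiplier \<open>C\<close>.\<close>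
    have "0 \<le> S * (P * W / S + C * f)\<^sup>2" using S by simp
    also have "\<dots> = P\<^sup>2 / S * W\<^sup>2 + 2 * C * P * f * W + C\<^sup>2 * S * f\<^sup>2"
      using S by (simp add: field_simps power2_eq_square)
    finally show ?thesis by simp
  qed
  \<comment> \<open>With \<open>E\<close> = Z\<phi>, the number - \<open>T\<close> / 2 is the
    logarithmic derivative along Z of the ground state, so the square vanishes exactly when \<phi>
    has the same logarithmic derivative along Z.\<close>
  have "0 \<le> 2 * S * (E + f * T / 2)\<^sup>2" using S by simp
  then have "- 2 * (S * E\<^sup>2) - 2 * S * f * E * T \<le> S * f\<^sup>2 * T\<^sup>2 / 2"
    by (simp add: field_simps power2_eq_square)
  then have "- 2 * (P * G) - 2 * S * f * E * T \<le> S * f\<^sup>2 * T\<^sup>2 / 2" using E by linarith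
  then have 2: "C * (- 2 * (P * G) - 2 * S * f * E * T) \<le> C * (S * f\<^sup>2 * T\<^sup>2 / 2)"
    using \<open>C \<ge> 0\<close> by (rule mult_left_mono)
  \<comment> \<open>With a = Q + \<alpha> - 4, the terms a \<open>l\<close> cancel, a^2 / 2 - (Q -
    2) a equals - 2 \<open>C\<close>, and half of \<open>l^2\<close> survives as the logarithmic
    remainder.\<close>
  have 3: "C * (S * f\<^sup>2 * T\<^sup>2 / 2) - C * (S * f\<^sup>2 * ((Q - 2 + l) * (Q + \<alpha> - 4) + l\<^sup>2))
     = - 2 * C\<^sup>2 * S * f\<^sup>2 - C / 2 * (S * f\<^sup>2 * l\<^sup>2)"
    unfolding T_def C by (simp add: field_simps power2_eq_square)
  have "C * (P * (- 2 * (G + f * W)) + S * (- 2 * (f * E * (\<alpha> - 2 + (Q - 2) + l))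
       - f\<^sup>2 * ((Q - 2 + l) * (Q + \<alpha> - 4) + l\<^sup>2)))
    = C * (- 2 * (P * G) - 2 * S * f * E * T) - 2 * C * P * f * W
      - C * (S * f\<^sup>2 * ((Q - 2 + l) * (Q + \<alpha> - 4) + l\<^sup>2))"
    unfolding T_def by (simp add: algebra_simps)
  then show ?thesis using 1 2 3 by linarith
qed

text \<open>In substance the inequality between the Grushin gradients of \<rho> and of a function
  with partial derivatives \<open>p\<close>, \<open>s\<close>. Cauchy-Schwarz is applied in x and in
  y, then once more between the two resulting pairs of norms, without dividing by |x|.\<close>

lemma cauchy_schwarz_gauge:
  fixes z :: "(real^'m) \<times> (real^'k)" and p :: "real^'m" and s :: "real^'k"
  assumes "\<gamma> > 0" "z \<noteq> 0"
  shows "sing_weight \<gamma> \<alpha> z * (fst z \<bullet> p + (1 + \<gamma>) * (snd z \<bullet> s))\<^sup>2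
     \<le> gauge \<gamma> z powr (\<alpha> - 2) * ((norm p)\<^sup>2 + norm (fst z) powr (2 * \<gamma>) * (norm s)\<^sup>2)"
proof -
  define n where "n = norm (fst z) powr (2 * \<gamma>)"
  define X where "X = norm (fst z)"
  define Y where "Y = (1 + \<gamma>) * norm (snd z)"
  let ?E = "fst z \<bullet> p + (1 + \<gamma>) * (snd z \<bullet> s)"
  have "\<bar>?E\<bar> \<le> \<bar>fst z \<bullet> p\<bar> + (1 + \<gamma>) * \<bar>snd z \<bullet> s\<bar>"
    using assms(1) by (simp add: abs_mult order_trans[OF abs_triangle_ineq])
  also have "\<dots> \<le> X * norm p + (1 + \<gamma>) * (norm (snd z) * norm s)"
    unfolding X_def using assms(1) by (intro add_mono mult_left_mono Cauchy_Schwarz_ineq2) auto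
  finally have "\<bar>?E\<bar> \<le> X * norm p + Y * norm s" by (simp add: Y_def mult.assoc)
  then have "?E\<^sup>2 \<le> (X * norm p + Y * norm s)\<^sup>2"
    by (metis abs_le_square_iff abs_ge_zero abs_of_nonneg order_trans)
  then have "n * ?E\<^sup>2 \<le> n * (X * norm p + Y * norm s)\<^sup>2"
    by (intro mult_left_mono) (simp_all add: n_def)
  also have "\<dots> \<le> (n * X\<^sup>2 + Y\<^sup>2) * ((norm p)\<^sup>2 + n * (norm s)\<^sup>2)"
  proof -
    \<comment> \<open>Lagrange's identity: this square is exactly the difference of the two
      sides.\<close>
    have "0 \<le> (n * X * norm s - Y * norm p)\<^sup>2" by simp
    then show ?thesis by (simp add: power2_eq_square algebra_simps)
  qed
  also have "n * X\<^sup>2 + Y\<^sup>2 = gauge \<gamma> z powr (2 * (1 + \<gamma>))"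
    unfolding n_def X_def Y_def gauge_powr[OF assms(1)] norm_powr_square[OF assms(1)] power_mult_distrib ..
  finally have "gauge \<gamma> z powr (\<alpha> - 4 - 2 * \<gamma>) * (n * ?E\<^sup>2)
    \<le> gauge \<gamma> z powr (\<alpha> - 4 - 2 * \<gamma>) * (gauge \<gamma> z powr (2 * (1 + \<gamma>)) * ((norm p)\<^sup>2 + n * (norm s)\<^sup>2))"
    by (intro mult_left_mono) auto
  also have "\<dots> = gauge \<gamma> z powr (\<alpha> - 2) * ((norm p)\<^sup>2 + n * (norm s)\<^sup>2)"
    unfolding mult.assoc[symmetric] powr_add[symmetric] by (simp add: algebra_simps)
  finally show ?thesis by (simp add: sing_weight_def n_def mult.assoc)
qed

lemma sing_weight_eq: "sing_weight \<gamma> \<alpha> z = gauge \<gamma> z powr (\<alpha> - 4) * (grad_gauge_norm \<gamma> z)\<^sup>2"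
  by (simp add: sing_weight_def grad_gauge_norm_def power_divide powr_diff power2_eq_square powr_add[symmetric])

lemma rellich_weight_eq:
  assumes "\<gamma> > 0" "fst z \<noteq> 0"
  shows "gauge \<gamma> z powr \<alpha> / (grad_gauge_norm \<gamma> z)\<^sup>2 = (gauge \<gamma> z powr (\<alpha> - 2))\<^sup>2 / sing_weight \<gamma> \<alpha> z"
proof -
  have "z \<noteq> 0" using assms by auto
  then have g: "0 < gauge \<gamma> z" using gauge_pos_iff[OF assms(1), of z] by simp
  have "grad_gauge_norm \<gamma> z > 0" using g assms(2) by (simp add: grad_gauge_norm_def)
  moreover have "gauge \<gamma> z powr \<alpha> * gauge \<gamma> z powr (\<alpha> - 4) = (gauge \<gamma> z powr (\<alpha> - 2))\<^sup>2"
    by (simp add: power2_eq_square powr_add[symmetric])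
  ultimately show ?thesis using g by (simp add: sing_weight_eq field_simps)
qed

context
  fixes \<gamma> \<alpha> r :: real and \<phi> :: "(real^'m) \<times> (real^'k) \<Rightarrow> real" and K
  assumes \<gamma>: "\<gamma> > 0" and \<alpha>: "\<alpha> - 4 > - Qdim \<gamma> TYPE('m) TYPE('k)" and r: "r > 0"
    and \<phi>: "smooth_fun \<phi>" and cK: "compact K" and Kr: "K \<subseteq> gball \<gamma> r"
    and supp: "{z. \<phi> z \<noteq> 0} \<subseteq> K"
begin

definition div_flux :: "(real^'m) \<times> (real^'k) \<Rightarrow> real" where
  "div_flux z = (\<Sum>i\<in>UNIV. x_flux_deriv \<gamma> \<alpha> r \<phi> (Qdim \<gamma> TYPE('m) TYPE('k) - 2) i z)
     + (\<Sum>j\<in>UNIV. y_flux_deriv \<gamma> \<alpha> r \<phi> (Qdim \<gamma> TYPE('m) TYPE('k) - 2) j z)"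

lemma div_flux: "integrable lborel div_flux" "(LINT z|lborel. div_flux z) = 0"
proof -
  note x = x_flux_deriv[OF \<gamma> \<alpha> r \<phi> cK Kr supp] and y = y_flux_deriv[OF \<gamma> \<alpha> r \<phi> cK Kr supp]
  show "integrable lborel div_flux"
    unfolding div_flux_def by (intro Bochner_Integration.integrable_add Bochner_Integration.integrable_sum x(1) y(1))
  show "(LINT z|lborel. div_flux z) = 0"
    unfolding div_flux_def
    by (simp add: Bochner_Integration.integral_add Bochner_Integration.integral_sum
        Bochner_Integration.integrable_sum x y)
qed

lemma div_flux_off: "z \<notin> K \<Longrightarrow> div_flux z = 0"
  by (simp add: div_flux_def flux_deriv_def off[OF \<gamma> \<alpha> r \<phi> cK Kr supp] dirderiv_off[OF \<gamma> \<alpha> r \<phi> cK Kr supp])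

text \<open>Both kinds of shares sum to 1 and the \<open>c\<close> sum to Q, so the coefficient of Q
  - 2 + \<open>l\<close> becomes Q + (\<alpha> - 4 - 2\<gamma>) + 2\<gamma> = Q + \<alpha> - 4. This
  takes the place of a separate formula for the Grushin operator applied to \<rho>.\<close>

lemma div_flux_eq:
  assumes "fst z \<noteq> 0"
    and p_def: "p = (\<chi> i. dirderiv \<phi> (axis i 1, 0) z)" and s_def: "s = (\<chi> j. dirderiv \<phi> (0, axis j 1) z)"
    and Q_def: "Q = Qdim \<gamma> TYPE('m) TYPE('k)" and l_def: "l = 1 / log_gauge \<gamma> r z"
  shows "div_flux z = gauge \<gamma> z powr (\<alpha> - 2) 
      * (- 2 * ((norm p)\<^sup>2 + norm (fst z) powr (2 * \<gamma>) * (norm s)\<^sup>2 + \<phi> z * grushin_lap \<gamma> \<phi> z))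
     + sing_weight \<gamma> \<alpha> z * (- 2 * (\<phi> z * (fst z \<bullet> p + (1 + \<gamma>) * (snd z \<bullet> s)) * (\<alpha> - 2 + (Q - 2) + l))
       - (\<phi> z)\<^sup>2 * ((Q - 2 + l) * (Q + \<alpha> - 4) + l\<^sup>2))"
proof -
  have "z \<noteq> 0" using assms(1) by auto
  note sh = sum_shares[OF \<gamma> this] sum_radial_share[OF assms(1)]
  define ex where "ex = (\<Sum>i\<in>UNIV. x_share \<gamma> i z)"
  define ey where "ey = (\<Sum>j\<in>UNIV. y_share \<gamma> j z)"
  have ey: "ey = 1 - ex" using sh(1) by (simp add: ex_def ey_def)
  have np: "(norm p)\<^sup>2 = (\<Sum>i\<in>UNIV. (dirderiv \<phi> (axis i 1, 0) z)\<^sup>2)"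
    and ns: "(norm s)\<^sup>2 = (\<Sum>j\<in>UNIV. (dirderiv \<phi> (0, axis j 1) z)\<^sup>2)"
    by (simp_all add: norm_vec_sum p_def s_def)
  have ip: "fst z \<bullet> p = (\<Sum>i\<in>UNIV. fst z $ i * dirderiv \<phi> (axis i 1, 0) z)"
    and ips: "(1 + \<gamma>) * (snd z \<bullet> s) = (\<Sum>j\<in>UNIV. (1 + \<gamma>) * snd z $ j * dirderiv \<phi> (0, axis j 1) z)"
    by (simp_all add: inner_vec_def p_def s_def sum_distrib_left mult.assoc)
  have Q: "Q = real CARD('m) + (1 + \<gamma>) * real CARD('k)" by (simp add: Q_def Qdim_def)
  show ?thesis
    unfolding div_flux_def flux_deriv_def l_def[symmetric] Q_def[symmetric]
    unfolding sum_flux_terms[OF finite]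
    unfolding np[symmetric] ns[symmetric] ip[symmetric] ips[symmetric] ex_def[symmetric] ey_def[symmetric] sh(2) ey
    by (simp add: grushin_lap_def) (simp add: Q algebra_simps power2_eq_square)
qed

end

theorem theorem4p3:
  fixes \<gamma> \<alpha> r :: real and \<phi> :: "(real^'m) \<times> (real^'k) \<Rightarrow> real"
  assumes "\<gamma> > 0"
    and "4 - Qdim \<gamma> TYPE('m) TYPE('k) < \<alpha>" and "\<alpha> < Qdim \<gamma> TYPE('m) TYPE('k)"
    and "r > 0"
    and "smooth_fun \<phi>"
    and "compact (closure {z. \<phi> z \<noteq> 0})"
    and "closure {z. \<phi> z \<noteq> 0} \<subseteq> gball \<gamma> r"
  shows "(\<integral>\<^sup>+ z\<in>gball \<gamma> r.
            ennreal (gauge \<gamma> z powr \<alpha> / (grad_gauge_norm \<gamma> z)\<^sup>2 * (grushin_lap \<gamma> \<phi> z)\<^sup>2) \<partial>lborel)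
         \<ge> ennreal ((Qdim \<gamma> TYPE('m) TYPE('k) + \<alpha> - 4)\<^sup>2 * (Qdim \<gamma> TYPE('m) TYPE('k) - \<alpha>)\<^sup>2 / 16) *
             (\<integral>\<^sup>+ z\<in>gball \<gamma> r.
                ennreal (gauge \<gamma> z powr (\<alpha> - 4) * (grad_gauge_norm \<gamma> z)\<^sup>2 * (\<phi> z)\<^sup>2) \<partial>lborel)
           + ennreal ((Qdim \<gamma> TYPE('m) TYPE('k) + \<alpha> - 4) * (Qdim \<gamma> TYPE('m) TYPE('k) - \<alpha>) / 8) *
             (\<integral>\<^sup>+ z\<in>gball \<gamma> r.
                ennreal (gauge \<gamma> z powr (\<alpha> - 4) * (grad_gauge_norm \<gamma> z)\<^sup>2 * (\<phi> z)\<^sup>2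
                         / (ln (r / gauge \<gamma> z))\<^sup>2) \<partial>lborel)"
proof -
  let ?Q = "Qdim \<gamma> TYPE('m) TYPE('k)"
  define K where "K = closure {z. \<phi> z \<noteq> 0}"
  have \<alpha>: "\<alpha> - 4 > - ?Q" using assms(2) by simp
  have cK: "compact K" and Kr: "K \<subseteq> gball \<gamma> r" using assms by (simp_all add: K_def)
  have supp: "{z. \<phi> z \<noteq> 0} \<subseteq> K"
    unfolding K_def by (rule closure_subset)
  note ctx = assms(1) \<alpha> assms(4,5) cK Kr supp
  note off = off[OF ctx]
  define C where "C = (?Q + \<alpha> - 4) * (?Q - \<alpha>) / 4"
  have C: "C \<ge> 0" using assms by (simp add: C_def)
  have C2: "(?Q + \<alpha> - 4)\<^sup>2 * (?Q - \<alpha>)\<^sup>2 / 16 = C\<^sup>2" and C8: "(?Q + \<alpha> - 4) * (?Q - \<alpha>) / 8 = C / 2"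
    by (simp_all add: C_def power_mult_distrib power_divide)
  have cont: "continuous_on UNIV \<phi>" "continuous_on UNIV (dirderiv (dirderiv \<phi> v) v)" for v
    using assms(5) by (auto intro!: smooth_fun_continuous smooth_fun_dirderiv)
  have meas: "\<phi> \<in> borel_measurable borel" "dirderiv (dirderiv \<phi> v) v \<in> borel_measurable borel" for v
    by (intro borel_measurable_continuous_onI cont)+
  note [measurable] = assms(1) meas
  define F where "F z = indicator (gball \<gamma> r) z * 
     (gauge \<gamma> z powr \<alpha> / (grad_gauge_norm \<gamma> z)\<^sup>2 * (grushin_lap \<gamma> \<phi> z)\<^sup>2)" for z
  define G1 where "G1 z = sing_weight \<gamma> \<alpha> z * (\<phi> z * \<phi> z)" for z
  define G2 where "G2 z = sing_weight \<gamma> \<alpha> z * (\<phi> z * \<phi> z * (1 / log_gauge \<gamma> r z * (1 / log_gauge \<gamma> r z)))" for z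
  have Fm: "F \<in> borel_measurable lborel"
    unfolding F_def grushin_lap_def by measurable
  have F0: "0 \<le> F z" for z by (simp add: F_def)
  have b\<phi>: "bounded (\<phi> ` K)"
    using cK cont(1) by (meson compact_continuous_image compact_imp_bounded continuous_on_subset top_greatest)
  have G1: "integrable lborel G1"
    unfolding G1_def
    by (rule integrable_sing_weight[OF ctx]) (auto intro!: bounded_image_mult b\<phi> simp: off)
  have G2: "integrable lborel G2"
    unfolding G2_def
  proof (rule integrable_sing_weight[OF ctx])
    show "bounded ((\<lambda>z. \<phi> z * \<phi> z * (1 / log_gauge \<gamma> r z * (1 / log_gauge \<gamma> r z))) ` K)"
      by (intro bounded_image_mult b\<phi> log_gauge_bounded[OF assms(1,4) cK Kr])
  qed (simp_all add: off)
  have G0: "0 \<le> G1 z" "0 \<le> G2 z" for z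
    by (simp_all add: G1_def G2_def sing_weight_nonneg)
  let ?H = "div_flux \<gamma> \<alpha> r \<phi>"
  note H = div_flux[OF ctx]
  have pw: "C * ?H z + (C\<^sup>2 * G1 z + C / 2 * G2 z) \<le> F z" if z: "fst z \<noteq> 0" for z
  proof (cases "z \<in> K")
    case False
    then show ?thesis using F0[of z] by (simp add: div_flux_off[OF ctx] G1_def G2_def off)
  next
    case True
    have z0: "z \<noteq> 0" using z by auto
    then have g: "0 < gauge \<gamma> z" using gauge_pos_iff[OF assms(1), of z] by simp
    have S: "0 < sing_weight \<gamma> \<alpha> z" using g z by (simp add: sing_weight_def)
    have "C * ?H z + (C\<^sup>2 * (sing_weight \<gamma> \<alpha> z * (\<phi> z)\<^sup>2)
        + C / 2 * (sing_weight \<gamma> \<alpha> z * (\<phi> z)\<^sup>2 * (1 / log_gauge \<gamma> r z)\<^sup>2))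
      \<le> (gauge \<gamma> z powr (\<alpha> - 2))\<^sup>2 / sing_weight \<gamma> \<alpha> z * (grushin_lap \<gamma> \<phi> z)\<^sup>2"
      unfolding div_flux_eq[OF ctx z refl refl refl refl]
      by (rule rellich_pointwise[OF S cauchy_schwarz_gauge[OF assms(1) z0] C C_def])
    moreover have "z \<in> gball \<gamma> r" using True Kr by blast
    ultimately show ?thesis
      unfolding F_def rellich_weight_eq[OF assms(1) z] G1_def G2_def
      by (simp add: power2_eq_square)
  qed
  \<comment> \<open>The set x = 0 is null because m \<ge> 1. On it the quotient by |grad \<rho>|^2
    has the default value 0, so the pointwise bound is asserted only off this set.\<close>
  obtain i :: 'm where True by simp
  have "(axis i 1, 0) \<in> (Basis :: ((real^'m) \<times> (real^'k)) set)" by (simp add: Basis_prod_def axis_in_Basis_iff)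
  from AE_lborel_inner_neq[OF this, of 0]
  have AE_pw: "AE z in lborel. C * ?H z + (C\<^sup>2 * G1 z + C / 2 * G2 z) \<le> F z"
  proof eventually_elim
    case (elim z)
    then have "fst z \<noteq> 0" by (auto simp: inner_prod_def)
    then show ?case by (rule pw)
  qed
  have int: "integrable lborel (\<lambda>z. C\<^sup>2 * G1 z + C / 2 * G2 z)" using G1 G2 by simp
  have "(\<integral>\<^sup>+ z. ennreal (F z) \<partial>lborel) \<ge> ennreal (C\<^sup>2 * (LINT z|lborel. G1 z) + C / 2 * (LINT z|lborel. G2 z))"
  \<comment> \<open>An infinite left-hand side is trivial; a finite one makes \<open>F\<close>
    integrable, so that the pointwise bound can be integrated with real-valued integrals and the
    divergence drops out.\<close>
  proof (cases "(\<integral>\<^sup>+ z. ennreal (F z) \<partial>lborel) < \<infinity>")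
    case True
    have F: "integrable lborel F" using Fm F0 True by (intro integrableI_nonneg) auto
    have "(LINT z|lborel. C * ?H z + (C\<^sup>2 * G1 z + C / 2 * G2 z)) \<le> (LINT z|lborel. F z)"
      using H(1) int F AE_pw by (intro integral_mono_AE) auto
    also have "(LINT z|lborel. C * ?H z + (C\<^sup>2 * G1 z + C / 2 * G2 z)) = C\<^sup>2 * (LINT z|lborel. G1 z) + C / 2 * (LINT z|lborel. G2 z)"
      using H G1 G2 by simp
    finally show ?thesis
      using nn_integral_eq_integral[OF F] F0 by (simp add: ennreal_leI)
  qed (simp add: not_less top_unique)
  also have "ennreal (C\<^sup>2 * (LINT z|lborel. G1 z) + C / 2 * (LINT z|lborel. G2 z))
    = ennreal (C\<^sup>2) * (\<integral>\<^sup>+ z. ennreal (G1 z) \<partial>lborel) + ennreal (C / 2) * (\<integral>\<^sup>+ z. ennreal (G2 z) \<partial>lborel)"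
  proof -
    have I: "0 \<le> (LINT z|lborel. G1 z)" "0 \<le> (LINT z|lborel. G2 z)" by (simp_all add: G0 integral_nonneg_AE)
    have "ennreal (C / 2 * (LINT z|lborel. G2 z)) = ennreal (C / 2) * ennreal (LINT z|lborel. G2 z)"
      using C I by (intro ennreal_mult) auto
    then show ?thesis
      using nn_integral_eq_integral[OF G1] nn_integral_eq_integral[OF G2] G0 C I
      by (simp only: ennreal_plus ennreal_mult mult_nonneg_nonneg zero_le_power2 AE_I2 divide_nonneg_nonneg zero_le_numeral)
  qed
  also have "(\<integral>\<^sup>+ z. ennreal (G1 z) \<partial>lborel) = (\<integral>\<^sup>+ z\<in>gball \<gamma> r.
                ennreal (gauge \<gamma> z powr (\<alpha> - 4) * (grad_gauge_norm \<gamma> z)\<^sup>2 * (\<phi> z)\<^sup>2) \<partial>lborel)"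
    \<comment> \<open>\<phi> vanishes outside \<open>K\<close>, which lies in the ball, so
      restricting the domain changes nothing.\<close>
    using off Kr by (intro nn_integral_cong) (auto simp: G1_def sing_weight_eq power2_eq_square split: split_indicator)
  also have "(\<integral>\<^sup>+ z. ennreal (G2 z) \<partial>lborel) = (\<integral>\<^sup>+ z\<in>gball \<gamma> r.
                ennreal (gauge \<gamma> z powr (\<alpha> - 4) * (grad_gauge_norm \<gamma> z)\<^sup>2 * (\<phi> z)\<^sup>2
                         / (ln (r / gauge \<gamma> z))\<^sup>2) \<partial>lborel)"
    using off Kr by (intro nn_integral_cong) 
      (auto simp: G2_def log_gauge_def sing_weight_eq power2_eq_square split: split_indicator)
  also have "(\<integral>\<^sup>+ z. ennreal (F z) \<partial>lborel) = (\<integral>\<^sup>+ z\<in>gball \<gamma> r.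
            ennreal (gauge \<gamma> z powr \<alpha> / (grad_gauge_norm \<gamma> z)\<^sup>2 * (grushin_lap \<gamma> \<phi> z)\<^sup>2) \<partial>lborel)"
    by (intro nn_integral_cong) (auto simp: F_def split: split_indicator)
  finally show ?thesis unfolding C2 C8 .
qed

end
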